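(* Let $(G_n)_{n\ge 1}$ be a sequence of finite connected graphs, let $f_n\colon \{0,1\}^{V(G_n)}\to\{0,1\}$, $n\ge 1$, be a sequence of functions, and let $(\alpha_n)_{n\ge1}$ be a sequence of strictly positive real numbers with $\alpha_n \le 1/\max_{v\in V(G_n)}\deg v$ for all $n$. Let $K_{|V(G_n)|}$ denote the complete graph with vertex set $V(G_n)$. Then: (i) if $(f_n)_{n\ge1}$ is exclusion sensitive with respect to $(G_n,\alpha_n)_{n\ge1}$, then $(f_n)_{n\ge1}$ is exclusion sensitive with respect to $(K_{|V(G_n)|},1/|V(G_n)|)_{n\ge1}$; (ii) if $(f_n)_{n\ge1}$ is exclusion stable with respect to $(K_{|V(G_n)|},1/|V(G_n)|)_{n\ge1}$, then $(f_n)_{n\ge1}$ is exclusion stable with respect to $(G_n,\alpha_n)_{n\ge1}$.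
   Context: For a finite graph $G$ and $\alpha>0$, the symmetric exclusion process on $\{0,1\}^{V(G)}$ with rate $\alpha$ is the continuous-time Markov chain $(X_t)_{t\ge0}$ defined as follows: each edge $e\in E(G)$ carries an independent Poisson clock of rate $\alpha$, and when the clock of $e$ rings, the values of the configuration at the two endpoints of $e$ are interchanged. Equivalently, its generator is $Qf(x)=\alpha\sum_{e\in E(G)}(f(x_e)-f(x))$, where $x_e$ is obtained from $x$ by interchanging the values at the endpoints of $e$. The process with respect to $(G,\alpha)$ is started from $X_0$ uniformly distributed on $\{0,1\}^{V(G)}$ (which is a stationary distribution). Let $(G_n)_{n\ge1}$ be finite connected graphs, $\alpha_n>0$, and let $X^{(n)}$ be the symmetric exclusion process with respect to $(G_n,\alpha_n)$. A sequence $f_n\colon\{0,1\}^{V(G_n)}\to\{0,1\}$ is exclusion sensitive with respect to $(G_n,\alpha_n)_{n\ge1}$ if $\lim_{n\to\infty}\mathrm{Cov}(f_n(X^{(n)}_0),f_n(X^{(n)}_1))=0$. It is exclusion stable with respect to $(G_n,\alpha_n)_{n\ge1}$ if $\lim_{\varepsilon\to0}\limsup_{n\to\infty}P(f_n(X^{(n)}_0)\neq f_n(X^{(n)}_\varepsilon))=0$. *)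

theory Defs
  imports "HOL-Probability.Probability"
begin

definition simple_graph :: "'v set \<Rightarrow> 'v set set \<Rightarrow> bool" where
  "simple_graph V E \<longleftrightarrow> finite V \<and> V \<noteq> {} \<and> E \<subseteq> {e. e \<subseteq> V \<and> card e = 2}"

definition connected_graph :: "'v set \<Rightarrow> 'v set set \<Rightarrow> bool" where
  "connected_graph V E \<longleftrightarrow> (\<forall>u\<in>V. \<forall>v\<in>V. (u, v) \<in> {(a, b). {a, b} \<in> E}\<^sup>*)"

definition vdegree :: "'v set set \<Rightarrow> 'v \<Rightarrow> nat" where
  "vdegree E v = card {e \<in> E. v \<in> e}"

definition max_degree :: "'v set \<Rightarrow> 'v set set \<Rightarrow> nat" where
  "max_degree V E = Max (vdegree E ` V)"

definition complete_edges :: "'v set \<Rightarrow> 'v set set" where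
  "complete_edges V = {e. e \<subseteq> V \<and> card e = 2}"

definition configs :: "'v set \<Rightarrow> ('v \<Rightarrow> nat) set" where
  "configs V = V \<rightarrow>\<^sub>E {0, 1}"

text \<open>For an edge \<open>e\<close> and \<open>v \<in> e\<close>, the element of \<open>e - {v}\<close> is the other endpoint of \<open>e\<close>.\<close>

definition interchange :: "'v set \<Rightarrow> ('v \<Rightarrow> nat) \<Rightarrow> ('v \<Rightarrow> nat)" where
  "interchange e x = (\<lambda>v. if v \<in> e then x (the_elem (e - {v})) else x v)"

definition excl_gen ::
  "'v set set \<Rightarrow> real \<Rightarrow> (('v \<Rightarrow> nat) \<Rightarrow> real) \<Rightarrow> (('v \<Rightarrow> nat) \<Rightarrow> real)" where
  "excl_gen E \<alpha> f = (\<lambda>x. \<alpha> * (\<Sum>e\<in>E. f (interchange e x) - f x))"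

text \<open>
  The transition semigroup \<open>exp (t Q)\<close> of the continuous-time Markov chain with generator
  \<open>Q = excl_gen E \<alpha>\<close>, as the (absolutely convergent) exponential series.
\<close>

definition excl_semigroup ::
  "'v set set \<Rightarrow> real \<Rightarrow> real \<Rightarrow> (('v \<Rightarrow> nat) \<Rightarrow> real) \<Rightarrow> (('v \<Rightarrow> nat) \<Rightarrow> real)" where
  "excl_semigroup E \<alpha> t f = (\<lambda>x. \<Sum>k. t ^ k / fact k * (excl_gen E \<alpha> ^^ k) f x)"

definition excl_trans ::
  "'v set set \<Rightarrow> real \<Rightarrow> real \<Rightarrow> ('v \<Rightarrow> nat) \<Rightarrow> ('v \<Rightarrow> nat) \<Rightarrow> real" where
  "excl_trans E \<alpha> t x y = excl_semigroup E \<alpha> t (indicator {y}) x"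

text \<open>
  The joint law of \<open>(X\<^sub>0, X\<^sub>t)\<close> when \<open>X\<^sub>0\<close> is uniform on the configurations. The conversion
  \<open>ennreal\<close> truncates negative reals to \<open>0\<close>, but the weights are nonnegative and sum to \<open>1\<close>:
  see \<open>excl_trans_nonneg\<close>, \<open>sum_excl_trans\<close> and \<open>prob_space_exclusion_law\<close> below.
\<close>

definition exclusion_law ::
  "'v set \<Rightarrow> 'v set set \<Rightarrow> real \<Rightarrow> real \<Rightarrow> (('v \<Rightarrow> nat) \<times> ('v \<Rightarrow> nat)) measure" where
  "exclusion_law V E \<alpha> t =
     point_measure (configs V \<times> configs V)
       (\<lambda>(x, y). ennreal (1 / real (card (configs V)) * excl_trans E \<alpha> t x y))"

definition covariance :: "'a measure \<Rightarrow> ('a \<Rightarrow> real) \<Rightarrow> ('a \<Rightarrow> real) \<Rightarrow> real" where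
  "covariance M X Y = (\<integral>w. X w * Y w \<partial>M) - (\<integral>w. X w \<partial>M) * (\<integral>w. Y w \<partial>M)"

definition exclusion_sensitive ::
  "(nat \<Rightarrow> ('v \<Rightarrow> nat) \<Rightarrow> real) \<Rightarrow> (nat \<Rightarrow> 'v set) \<Rightarrow> (nat \<Rightarrow> 'v set set) \<Rightarrow> (nat \<Rightarrow> real) \<Rightarrow> bool"
  where
  "exclusion_sensitive f V E \<alpha> \<longleftrightarrow>
     (\<lambda>n. covariance (exclusion_law (V n) (E n) (\<alpha> n) 1)
            (\<lambda>(x, y). f n x) (\<lambda>(x, y). f n y)) \<longlonglongrightarrow> 0"

definition exclusion_stable ::
  "(nat \<Rightarrow> ('v \<Rightarrow> nat) \<Rightarrow> real) \<Rightarrow> (nat \<Rightarrow> 'v set) \<Rightarrow> (nat \<Rightarrow> 'v set set) \<Rightarrow> (nat \<Rightarrow> real) \<Rightarrow> bool"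
  where
  "exclusion_stable f V E \<alpha> \<longleftrightarrow>
     ((\<lambda>\<epsilon>. limsup (\<lambda>n. ereal (\<P>((x, y) in exclusion_law (V n) (E n) (\<alpha> n) \<epsilon>. f n x \<noteq> f n y))))
        \<longlongrightarrow> 0) (at_right 0)"

lemma finite_configs: "finite V \<Longrightarrow> finite (configs V)"
  unfolding configs_def by (rule finite_PiE) auto

lemma configs_nonempty: "configs V \<noteq> {}"
  by (auto simp: configs_def PiE_eq_empty_iff)

lemma interchange_in_configs:
  assumes "e \<subseteq> V" "card e = 2" "x \<in> configs V"
  shows "interchange e x \<in> configs V"
proof -
  from assms(2) obtain a b where e: "e = {a, b}" "a \<noteq> b" by (meson card_2_iff)
  have "{a, b} - {a} = {b}" "{a, b} - {b} = {a}" using e by auto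
  then show ?thesis
    using assms(1,3) e unfolding configs_def interchange_def
    by (auto simp: PiE_iff extensional_def)
qed

definition excl_jump ::
  "'v set set \<Rightarrow> real \<Rightarrow> (('v \<Rightarrow> nat) \<Rightarrow> real) \<Rightarrow> (('v \<Rightarrow> nat) \<Rightarrow> real)" where
  "excl_jump E \<alpha> f = (\<lambda>x. \<alpha> * (\<Sum>e\<in>E. f (interchange e x)))"

lemma excl_gen_jump: "excl_gen E \<alpha> f x = excl_jump E \<alpha> f x + (- (\<alpha> * card E)) * f x"
  by (simp add: excl_gen_def excl_jump_def sum_subtractf algebra_simps)

lemma excl_jump_sum:
  "excl_jump E \<alpha> (\<lambda>x. \<Sum>i\<in>I. c i * g i x) x = (\<Sum>i\<in>I. c i * excl_jump E \<alpha> (g i) x)"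
proof -
  have "excl_jump E \<alpha> (\<lambda>x. \<Sum>i\<in>I. c i * g i x) x =
      (\<Sum>e\<in>E. \<Sum>i\<in>I. \<alpha> * (c i * g i (interchange e x)))"
    by (simp add: excl_jump_def sum_distrib_left)
  also have "\<dots> = (\<Sum>i\<in>I. \<Sum>e\<in>E. \<alpha> * (c i * g i (interchange e x)))"
    by (rule sum.swap)
  finally show ?thesis
    by (simp add: excl_jump_def sum_distrib_left mult.left_commute)
qed

lemma excl_gen_power:
  "(excl_gen E \<alpha> ^^ k) f =
     (\<lambda>x. \<Sum>i\<le>k. (real (k choose i) * (- (\<alpha> * card E)) ^ (k - i)) * (excl_jump E \<alpha> ^^ i) f x)"
proof (induction k)
  case 0
  then show ?case by simp
next
  case (Suc k)
  define d where "d = - (\<alpha> * card E)"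
  show ?case
  proof
    fix x
    define a where "a i = (excl_jump E \<alpha> ^^ i) f x" for i
    have "(excl_gen E \<alpha> ^^ Suc k) f x = excl_gen E \<alpha> ((excl_gen E \<alpha> ^^ k) f) x" by simp
    also have "\<dots> = (\<Sum>i\<le>k. (real (k choose i) * d ^ (k - i)) * a (Suc i))
        + d * (\<Sum>i\<le>k. (real (k choose i) * d ^ (k - i)) * a i)"
      unfolding Suc.IH excl_gen_jump excl_jump_sum a_def d_def by simp
    also have "d * (\<Sum>i\<le>k. (real (k choose i) * d ^ (k - i)) * a i)
        = (\<Sum>i\<le>Suc k. (real (k choose i) * d ^ (Suc k - i)) * a i)"
      by (simp add: sum_distrib_left Suc_diff_le mult_ac)
    also have "\<dots> = d ^ Suc k * a 0
        + (\<Sum>i\<le>k. (real (k choose Suc i) * d ^ (k - i)) * a (Suc i))"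
      by (subst sum.atMost_Suc_shift) simp
    also have "(\<Sum>i\<le>k. (real (k choose i) * d ^ (k - i)) * a (Suc i)) + \<dots>
        = (\<Sum>i\<le>Suc k. (real (Suc k choose i) * d ^ (Suc k - i)) * a i)"
      by (subst sum.atMost_Suc_shift) (simp add: sum.distrib algebra_simps)
    finally show "(excl_gen E \<alpha> ^^ Suc k) f x = (\<Sum>i\<le>Suc k. (real (Suc k choose i) *
        (- (\<alpha> * card E)) ^ (Suc k - i)) * (excl_jump E \<alpha> ^^ i) f x)"
      unfolding a_def d_def .
  qed
qed

lemma excl_jump_power_bound:
  assumes "0 \<le> \<alpha>" "\<And>x. \<bar>f x\<bar> \<le> B"
  shows "\<bar>(excl_jump E \<alpha> ^^ k) f x\<bar> \<le> (\<alpha> * card E) ^ k * B"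
proof (induction k arbitrary: x)
  case 0
  then show ?case using assms by simp
next
  case (Suc k)
  have "\<bar>\<Sum>e\<in>E. (excl_jump E \<alpha> ^^ k) f (interchange e x)\<bar> \<le> (\<Sum>e\<in>E. (\<alpha> * card E) ^ k * B)"
    by (rule order_trans[OF sum_abs]) (intro sum_mono Suc.IH)
  then have "\<alpha> * \<bar>\<Sum>e\<in>E. (excl_jump E \<alpha> ^^ k) f (interchange e x)\<bar>
      \<le> \<alpha> * (\<Sum>e\<in>E. (\<alpha> * card E) ^ k * B)"
    using assms(1) by (rule mult_left_mono)
  then show ?case
    using assms(1)
    by (simp add: excl_jump_def[of E \<alpha> "(excl_jump E \<alpha> ^^ k) f"] abs_mult mult_ac)
qed

lemma excl_jump_power_nonneg:
  assumes "0 \<le> \<alpha>" "\<And>x. 0 \<le> f x"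
  shows "0 \<le> (excl_jump E \<alpha> ^^ k) f x"
proof (induction k arbitrary: x)
  case 0
  then show ?case using assms by simp
next
  case (Suc k)
  then show ?case using assms by (auto simp: excl_jump_def intro!: mult_nonneg_nonneg sum_nonneg)
qed

lemma excl_semigroup_sums:
  fixes E :: "'v set set" and f :: "('v \<Rightarrow> nat) \<Rightarrow> real"
  assumes "0 \<le> \<alpha>" "\<And>x. \<bar>f x\<bar> \<le> B"
  defines "c \<equiv> \<alpha> * real (card E)"
  shows "summable (\<lambda>k. t ^ k / fact k * (excl_jump E \<alpha> ^^ k) f x)" (is "summable ?a")
    and "(\<lambda>k. t ^ k / fact k * (excl_gen E \<alpha> ^^ k) f x) sums
      ((\<Sum>k. t ^ k / fact k * (excl_jump E \<alpha> ^^ k) f x) * exp (- (c * t)))"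
proof -
  have "summable (\<lambda>k. (inverse (fact k) * (\<bar>t\<bar> * c) ^ k) * B)"
    by (intro summable_mult2 summable_exp)
  moreover have "norm (norm (?a k)) \<le> (inverse (fact k) * (\<bar>t\<bar> * c) ^ k) * B" for k
  proof -
    have "\<bar>t\<bar> ^ k / fact k * \<bar>(excl_jump E \<alpha> ^^ k) f x\<bar> \<le> \<bar>t\<bar> ^ k / fact k * (c ^ k * B)"
      using excl_jump_power_bound[OF assms(1,2)] unfolding c_def by (intro mult_left_mono) auto
    then show ?thesis
      by (simp add: abs_mult power_abs power_mult_distrib divide_inverse mult_ac)
  qed
  ultimately have a: "summable (\<lambda>k. norm (?a k))"
    by (rule summable_comparison_test'[where N = 0])
  then show "summable ?a" by (rule summable_norm_cancel)
  define b where "b k = (- (c * t)) ^ k /\<^sub>R fact k" for k :: nat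
  have b: "summable (\<lambda>k. norm (b k))" "suminf b = exp (- (c * t))"
    unfolding b_def by (rule summable_norm_exp, simp add: exp_def)
  have "(\<Sum>i\<le>k. ?a i * b (k - i)) = t ^ k / fact k * (excl_gen E \<alpha> ^^ k) f x" for k
  proof -
    have "?a i * b (k - i) = t ^ k / fact k *
        ((real (k choose i) * (- c) ^ (k - i)) * (excl_jump E \<alpha> ^^ i) f x)" if "i \<le> k" for i
    proof -
      have t: "t ^ k = t ^ i * t ^ (k - i)" using that by (simp flip: power_add)
      have c: "(- (c * t)) ^ (k - i) = (- c) ^ (k - i) * t ^ (k - i)"
        by (simp flip: power_mult_distrib)
      show ?thesis
        unfolding b_def binomial_fact[OF that] t c by (simp add: divide_inverse mult_ac)
    qed
    then show ?thesis
      by (simp add: excl_gen_power sum_distrib_left c_def)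
  qed
  with Cauchy_product_sums[OF a b(1)] b(2)
  show "(\<lambda>k. t ^ k / fact k * (excl_gen E \<alpha> ^^ k) f x) sums
      ((\<Sum>k. t ^ k / fact k * (excl_jump E \<alpha> ^^ k) f x) * exp (- (c * t)))"
    by simp
qed

lemma summable_excl_semigroup:
  assumes "0 \<le> \<alpha>" "\<And>x. \<bar>f x\<bar> \<le> B"
  shows "summable (\<lambda>k. t ^ k / fact k * (excl_gen E \<alpha> ^^ k) f x)"
  using excl_semigroup_sums(2)[OF assms] by (rule sums_summable)

lemma excl_trans_nonneg:
  assumes "0 \<le> \<alpha>" "0 \<le> t"
  shows "0 \<le> excl_trans E \<alpha> t x y"
proof -
  let ?f = "indicator {y} :: ('a \<Rightarrow> nat) \<Rightarrow> real"
  have bd: "\<bar>?f z\<bar> \<le> 1" for z by (simp add: indicator_def)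
  have "0 \<le> (\<Sum>k. t ^ k / fact k * (excl_jump E \<alpha> ^^ k) ?f x)"
    by (intro suminf_nonneg excl_semigroup_sums(1)[OF assms(1) bd] mult_nonneg_nonneg
        excl_jump_power_nonneg) (use assms in auto)
  moreover have "excl_trans E \<alpha> t x y =
      (\<Sum>k. t ^ k / fact k * (excl_jump E \<alpha> ^^ k) ?f x) * exp (- (\<alpha> * real (card E) * t))"
    unfolding excl_trans_def excl_semigroup_def
    by (rule sums_unique[symmetric, OF excl_semigroup_sums(2)[OF assms(1) bd]])
  ultimately show ?thesis by simp
qed

lemma excl_gen_sum:
  "excl_gen E \<alpha> (\<lambda>x. \<Sum>i\<in>I. g i x) x = (\<Sum>i\<in>I. excl_gen E \<alpha> (g i) x)"
  using excl_jump_sum[of E \<alpha> "\<lambda>_. 1" g I x]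
  by (simp add: excl_gen_jump sum.distrib sum_distrib_left sum_negf sum_subtractf)

lemma excl_gen_power_sum:
  "(excl_gen E \<alpha> ^^ k) (\<lambda>x. \<Sum>i\<in>I. g i x) x = (\<Sum>i\<in>I. (excl_gen E \<alpha> ^^ k) (g i) x)"
proof (induction k arbitrary: x)
  case 0
  then show ?case by simp
next
  case (Suc k)
  then have "(excl_gen E \<alpha> ^^ k) (\<lambda>x. \<Sum>i\<in>I. g i x) = (\<lambda>x. \<Sum>i\<in>I. (excl_gen E \<alpha> ^^ k) (g i) x)"
    by auto
  then show ?case by (simp add: excl_gen_sum)
qed

lemma excl_gen_power_one:
  assumes "E \<subseteq> {e. e \<subseteq> V \<and> card e = 2}" "x \<in> configs V" "\<And>y. y \<in> configs V \<Longrightarrow> f y = 1"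
  shows "(excl_gen E \<alpha> ^^ k) f x = (if k = 0 then 1 else 0)"
  using assms(2)
proof (induction k arbitrary: x)
  case 0
  then show ?case using assms by simp
next
  case (Suc k)
  have "(excl_gen E \<alpha> ^^ k) f (interchange e x) - (excl_gen E \<alpha> ^^ k) f x = 0" if "e \<in> E" for e
    using Suc.IH[OF Suc.prems] Suc.IH[OF interchange_in_configs[OF _ _ Suc.prems, of e]]
      assms(1) that by auto
  then have "(\<Sum>e\<in>E. (excl_gen E \<alpha> ^^ k) f (interchange e x) - (excl_gen E \<alpha> ^^ k) f x) = 0"
    by (rule sum.neutral[OF ballI])
  then show ?case unfolding funpow.simps comp_def excl_gen_def[of E \<alpha> "(excl_gen E \<alpha> ^^ k) f"] by simp
qed

lemma sum_excl_trans:
  assumes G: "simple_graph V E" and "0 \<le> \<alpha>" and x: "x \<in> configs V"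
  shows "(\<Sum>y\<in>configs V. excl_trans E \<alpha> t x y) = 1"
proof -
  have E: "E \<subseteq> {e. e \<subseteq> V \<and> card e = 2}" and fin: "finite (configs V)"
    using G by (auto simp: simple_graph_def intro: finite_configs)
  let ?ind = "\<lambda>y. indicator {y} :: ('a \<Rightarrow> nat) \<Rightarrow> real"
  have one: "(\<Sum>y\<in>configs V. ?ind y z) = 1" if "z \<in> configs V" for z
    using fin that by (simp add: indicator_def of_bool_def)
  have "(\<Sum>y\<in>configs V. excl_trans E \<alpha> t x y)
      = (\<Sum>k. \<Sum>y\<in>configs V. t ^ k / fact k * (excl_gen E \<alpha> ^^ k) (?ind y) x)"
    unfolding excl_trans_def excl_semigroup_def
    by (intro suminf_sum[symmetric] summable_excl_semigroup[where B = 1])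
      (use assms in \<open>auto simp: indicator_def\<close>)
  also have "\<dots> = (\<Sum>k. t ^ k / fact k * (excl_gen E \<alpha> ^^ k) (\<lambda>z. \<Sum>y\<in>configs V. ?ind y z) x)"
    by (simp add: excl_gen_power_sum sum_distrib_left)
  also have "\<dots> = (\<Sum>k. t ^ k / fact k * (if k = 0 then 1 else 0))"
    by (subst excl_gen_power_one[OF E x one]) auto
  also have "\<dots> = (\<Sum>k\<in>{0::nat}. t ^ k / fact k * (if k = 0 then 1 else 0))"
    by (rule suminf_finite) auto
  finally show ?thesis by simp
qed

lemma prob_space_exclusion_law:
  assumes "simple_graph V E" "0 \<le> \<alpha>" "0 \<le> t"
  shows "prob_space (exclusion_law V E \<alpha> t)"
proof
  have fin: "finite (configs V)"
    using assms by (auto simp: simple_graph_def intro: finite_configs)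
  have "(\<Sum>z\<in>configs V \<times> configs V. case z of (x, y) \<Rightarrow>
      1 / real (card (configs V)) * excl_trans E \<alpha> t x y)
      = (\<Sum>x\<in>configs V. 1 / real (card (configs V)) * (\<Sum>y\<in>configs V. excl_trans E \<alpha> t x y))"
    by (simp add: sum.cartesian_product sum_distrib_left)
  also have "\<dots> = 1"
    using fin configs_nonempty[of V] by (simp add: sum_excl_trans[OF assms(1,2)])
  finally have s: "(\<Sum>z\<in>configs V \<times> configs V. case z of (x, y) \<Rightarrow>
      1 / real (card (configs V)) * excl_trans E \<alpha> t x y) = 1" .
  have "emeasure (exclusion_law V E \<alpha> t) (space (exclusion_law V E \<alpha> t))
      = (\<Sum>z\<in>configs V \<times> configs V. ennreal (case z of (x, y) \<Rightarrow>
          1 / real (card (configs V)) * excl_trans E \<alpha> t x y))"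
    unfolding exclusion_law_def space_point_measure
    by (subst emeasure_point_measure_finite) (use fin in \<open>auto intro!: sum.cong\<close>)
  also have "\<dots> = ennreal 1"
    by (subst sum_ennreal) (use s in \<open>auto intro!: divide_nonneg_nonneg excl_trans_nonneg assms\<close>)
  finally show "emeasure (exclusion_law V E \<alpha> t) (space (exclusion_law V E \<alpha> t)) = 1" by simp
qed

end

theory Submission
  imports Defs "HOL-Combinatorics.Transposition"
begin

text \<open>
  The generator \<open>B\<close> of the exclusion process on the complete graph commutes with the generator
  \<open>A\<close> on any graph with the same vertices, since conjugating by a transposition permutes the edges
  of the complete graph. Writing \<open>(u v) = (u w) (v w) (u w)\<close> and averaging over \<open>w\<close> bounds the
  Dirichlet form of \<open>A\<close> by a constant \<open>C\<close> times that of \<open>B\<close>. For commuting symmetric operators this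
  gives \<open>\<langle>f, e\<^bsup>CtB\<^esup> f\<rangle> \<le> \<langle>f, e\<^bsup>tA\<^esup> f\<rangle>\<close>. Stability follows at once, because the probability that
  \<open>f\<close> changes by time \<open>t\<close> is an affine decreasing function of \<open>\<langle>f, e\<^bsup>tA\<^esup> f\<rangle>\<close>. For sensitivity, a
  covariance tending to \<open>0\<close> at time \<open>1\<close> also tends to \<open>0\<close> at time \<open>1/C\<close>, by log-convexity in time.
\<close>

section \<open>Exponentials of operators on functions over a finite set\<close>

text \<open>Functions are total, but only their values on \<open>\<Omega>\<close> matter. The kernel
  \<open>K\<close> encodes linearity together with the fact that \<open>T f\<close> on
  \<open>\<Omega>\<close> depends only on \<open>f\<close> on \<open>\<Omega>\<close>.\<close>

definition lin_op :: "'a set \<Rightarrow> (('a \<Rightarrow> real) \<Rightarrow> 'a \<Rightarrow> real) \<Rightarrow> bool" where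
  "lin_op \<Omega> T \<longleftrightarrow> (\<exists>K. \<forall>f. \<forall>x\<in>\<Omega>. T f x = (\<Sum>y\<in>\<Omega>. K x y * f y))"

definition exp_op :: "(('a \<Rightarrow> real) \<Rightarrow> 'a \<Rightarrow> real) \<Rightarrow> real \<Rightarrow> ('a \<Rightarrow> real) \<Rightarrow> 'a \<Rightarrow> real" where
  "exp_op T t f = (\<lambda>x. \<Sum>k. t ^ k / fact k * (T ^^ k) f x)"

definition ip :: "'a set \<Rightarrow> ('a \<Rightarrow> real) \<Rightarrow> ('a \<Rightarrow> real) \<Rightarrow> real" where
  "ip \<Omega> f g = (\<Sum>x\<in>\<Omega>. f x * g x)"

definition sym_op :: "'a set \<Rightarrow> (('a \<Rightarrow> real) \<Rightarrow> 'a \<Rightarrow> real) \<Rightarrow> bool" where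
  "sym_op \<Omega> T \<longleftrightarrow> lin_op \<Omega> T \<and> (\<forall>f g. ip \<Omega> (T f) g = ip \<Omega> f (T g))"

definition commute_on ::
  "'a set \<Rightarrow> (('a \<Rightarrow> real) \<Rightarrow> 'a \<Rightarrow> real) \<Rightarrow> (('a \<Rightarrow> real) \<Rightarrow> 'a \<Rightarrow> real) \<Rightarrow> bool" where
  "commute_on \<Omega> S T \<longleftrightarrow> (\<forall>f. \<forall>x\<in>\<Omega>. S (T f) x = T (S f) x)"

section \<open>Linear operators and the inner product\<close>

lemma lin_opI:
  "(\<And>f x. x \<in> \<Omega> \<Longrightarrow> T f x = (\<Sum>y\<in>\<Omega>. K x y * f y)) \<Longrightarrow> lin_op \<Omega> T"
  unfolding lin_op_def by blast

lemma lin_op_cong: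
  assumes "lin_op \<Omega> T" "\<And>y. y \<in> \<Omega> \<Longrightarrow> f y = g y" "x \<in> \<Omega>"
  shows "T f x = T g x"
  using assms unfolding lin_op_def by (metis (no_types, lifting) sum.cong)

lemma lin_op_sum:
  assumes "lin_op \<Omega> T" "x \<in> \<Omega>"
  shows "T (\<lambda>z. \<Sum>i\<in>I. c i * g i z) x = (\<Sum>i\<in>I. c i * T (g i) x)"
proof -
  obtain K where K: "\<And>f x. x \<in> \<Omega> \<Longrightarrow> T f x = (\<Sum>y\<in>\<Omega>. K x y * f y)"
    using assms(1) unfolding lin_op_def by blast
  show ?thesis
    using assms(2) by (simp add: K sum_distrib_left sum.swap[of _ \<Omega>] mult_ac)
qed

lemma ip_cong:
  "(\<And>x. x \<in> \<Omega> \<Longrightarrow> f x = f' x) \<Longrightarrow> (\<And>x. x \<in> \<Omega> \<Longrightarrow> g x = g' x) \<Longrightarrow> ip \<Omega> f g = ip \<Omega> f' g'"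
  unfolding ip_def by (auto intro: sum.cong)

lemma ip_commute: "ip \<Omega> f g = ip \<Omega> g f"
  by (simp add: ip_def mult.commute)

lemma ip_square: "(ip \<Omega> f g)\<^sup>2 \<le> ip \<Omega> f f * ip \<Omega> g g"
  using Cauchy_Schwarz_ineq_sum[of f g \<Omega>] by (simp add: ip_def power2_eq_square)

lemma ip_self_nonneg: "0 \<le> ip \<Omega> f f"
  by (simp add: ip_def sum_nonneg)

lemma exp_op_0 [simp]: "exp_op T 0 f = f"
proof
  fix x
  have "(\<Sum>k. 0 ^ k / fact k * (T ^^ k) f x) = (\<Sum>k\<in>{0::nat}. 0 ^ k / fact k * (T ^^ k) f x)"
    by (rule suminf_finite) auto
  then show "exp_op T 0 f x = f x" by (simp add: exp_op_def)
qed

section \<open>Convergence, commutation and differentiation of operator exponentials\<close>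

context
  fixes \<Omega> :: "'a set"
  assumes finite_\<Omega>: "finite \<Omega>"
begin

lemma lin_op_power_bound:
  assumes "lin_op \<Omega> T"
  obtains c B where "\<And>k x. x \<in> \<Omega> \<Longrightarrow> \<bar>(T ^^ k) f x\<bar> \<le> c ^ k * B"
proof -
  obtain K where K: "\<And>f x. x \<in> \<Omega> \<Longrightarrow> T f x = (\<Sum>y\<in>\<Omega>. K x y * f y)"
    using assms unfolding lin_op_def by blast
  \<comment> \<open>Crude choices suffice: \<open>c\<close> dominates every row sum of the kernel,
    and \<open>B\<close> the supremum of \<open>\<bar>f\<bar>\<close> on
    \<open>\<Omega>\<close>.\<close>
  define c where "c = (\<Sum>x\<in>\<Omega>. \<Sum>y\<in>\<Omega>. \<bar>K x y\<bar>)"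
  define B where "B = (\<Sum>x\<in>\<Omega>. \<bar>f x\<bar>)"
  have nn: "0 \<le> c" "0 \<le> B" by (auto simp: c_def B_def sum_nonneg)
  have "\<bar>(T ^^ k) f x\<bar> \<le> c ^ k * B" if "x \<in> \<Omega>" for k x
    using that
  proof (induction k arbitrary: x)
    case 0
    then show ?case using finite_\<Omega> by (auto simp: B_def intro: member_le_sum)
  next
    case (Suc k)
    have "\<bar>(T ^^ Suc k) f x\<bar> \<le> (\<Sum>y\<in>\<Omega>. \<bar>K x y\<bar> * \<bar>(T ^^ k) f y\<bar>)"
      using Suc.prems by (simp add: K flip: abs_mult)
    also have "\<dots> \<le> (\<Sum>y\<in>\<Omega>. \<bar>K x y\<bar> * (c ^ k * B))"
      by (intro sum_mono mult_left_mono Suc.IH) auto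
    also have "\<dots> = (\<Sum>y\<in>\<Omega>. \<bar>K x y\<bar>) * (c ^ k * B)"
      by (simp add: sum_distrib_right)
    also have "\<dots> \<le> c * (c ^ k * B)"
      using nn finite_\<Omega> Suc.prems unfolding c_def
      by (intro mult_right_mono member_le_sum[of x \<Omega> "\<lambda>x. \<Sum>y\<in>\<Omega>. \<bar>K x y\<bar>"])
        (auto simp: sum_nonneg)
    finally show ?case by simp
  qed
  then show thesis using that by blast
qed

lemma exp_op_summable:
  assumes "lin_op \<Omega> T" "x \<in> \<Omega>"
  shows "summable (\<lambda>k. t ^ k / fact k * (T ^^ k) f x)"
proof -
  obtain c B where b: "\<And>k x. x \<in> \<Omega> \<Longrightarrow> \<bar>(T ^^ k) f x\<bar> \<le> c ^ k * B"
    using lin_op_power_bound[OF assms(1)] by blast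
  have "summable (\<lambda>k. (inverse (fact k) * (\<bar>t\<bar> * c) ^ k) * B)"
    by (intro summable_mult2 summable_exp)
  moreover have "norm (t ^ k / fact k * (T ^^ k) f x)
      \<le> (inverse (fact k) * (\<bar>t\<bar> * c) ^ k) * B" for k
  proof -
    have "\<bar>t\<bar> ^ k / fact k * \<bar>(T ^^ k) f x\<bar> \<le> \<bar>t\<bar> ^ k / fact k * (c ^ k * B)"
      using b[OF assms(2)] by (intro mult_left_mono) auto
    then show ?thesis
      by (simp add: abs_mult power_abs power_mult_distrib divide_inverse mult_ac)
  qed
  ultimately show ?thesis
    by (rule summable_comparison_test'[where N = 0])
qed

lemma lin_op_funpow:
  assumes "lin_op \<Omega> T"
  shows "lin_op \<Omega> (T ^^ k)"
proof (induction k)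
  case 0
  have "f x = (\<Sum>y\<in>\<Omega>. of_bool (x = y) * f y)" if "x \<in> \<Omega>" for f :: "'a \<Rightarrow> real" and x
    using that finite_\<Omega> by (simp add: of_bool_def if_distrib[where f = "\<lambda>a. a * _"] cong: if_cong)
  then show ?case unfolding lin_op_def by (intro exI[of _ "\<lambda>x y. of_bool (x = y)"]) auto
next
  case (Suc k)
  obtain K where K: "\<And>f x. x \<in> \<Omega> \<Longrightarrow> T f x = (\<Sum>y\<in>\<Omega>. K x y * f y)"
    using assms unfolding lin_op_def by blast
  obtain L where L: "\<And>f x. x \<in> \<Omega> \<Longrightarrow> (T ^^ k) f x = (\<Sum>y\<in>\<Omega>. L x y * f y)"
    using Suc unfolding lin_op_def by blast
  have "(T ^^ Suc k) f x = (\<Sum>y\<in>\<Omega>. (\<Sum>z\<in>\<Omega>. K x z * L z y) * f y)" if "x \<in> \<Omega>" for f x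
    using that by (simp add: K L sum_distrib_left sum_distrib_right mult.assoc)
      (rule sum.swap)
  then show ?case by (rule lin_opI)
qed

text \<open>Expand \<open>f\<close> into indicators of points; the sum is finite and so passes
  through the series. For an exclusion generator the resulting kernel is the transition
  matrix.\<close>

lemma exp_op_kernel:
  assumes "lin_op \<Omega> T" "x \<in> \<Omega>"
  shows "exp_op T t f x = (\<Sum>y\<in>\<Omega>. exp_op T t (indicator {y}) x * f y)"
proof -
  have "(T ^^ k) f x = (\<Sum>y\<in>\<Omega>. f y * (T ^^ k) (indicator {y}) x)" for k
  proof -
    have "(T ^^ k) f x = (T ^^ k) (\<lambda>z. \<Sum>y\<in>\<Omega>. f y * indicator {y} z) x"
      using finite_\<Omega> by (intro lin_op_cong[OF lin_op_funpow[OF assms(1)] _ assms(2)])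
        (simp add: indicator_def of_bool_def if_distrib[where f = "\<lambda>a. _ * a"] cong: if_cong)
    then show ?thesis by (simp add: lin_op_sum[OF lin_op_funpow[OF assms(1)] assms(2)])
  qed
  then have "exp_op T t f x
      = (\<Sum>k. \<Sum>y\<in>\<Omega>. t ^ k / fact k * (T ^^ k) (indicator {y}) x * f y)"
    by (simp add: exp_op_def sum_distrib_left sum_divide_distrib mult_ac)
  also have "\<dots> = (\<Sum>y\<in>\<Omega>. \<Sum>k. t ^ k / fact k * (T ^^ k) (indicator {y}) x * f y)"
    by (intro suminf_sum summable_mult2 exp_op_summable assms)
  also have "\<dots> = (\<Sum>y\<in>\<Omega>. exp_op T t (indicator {y}) x * f y)"
    unfolding exp_op_def by (intro sum.cong refl suminf_mult2[symmetric] exp_op_summable assms)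
  finally show ?thesis .
qed

lemma lin_op_exp_op: "lin_op \<Omega> T \<Longrightarrow> lin_op \<Omega> (exp_op T t)"
  by (rule lin_opI) (rule exp_op_kernel)

lemma commute_on_funpow:
  assumes "lin_op \<Omega> T" "commute_on \<Omega> U T"
  shows "commute_on \<Omega> U (T ^^ k)"
proof (induction k)
  case 0
  then show ?case by (simp add: commute_on_def)
next
  case (Suc k)
  have "U ((T ^^ Suc k) f) x = (T ^^ Suc k) (U f) x" if "x \<in> \<Omega>" for f x
  proof -
    have "U ((T ^^ Suc k) f) x = T (U ((T ^^ k) f)) x"
      using assms(2) that by (simp add: commute_on_def)
    also have "\<dots> = T ((T ^^ k) (U f)) x"
      using Suc by (intro lin_op_cong[OF assms(1) _ that]) (simp add: commute_on_def)
    finally show ?thesis by simp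
  qed
  then show ?case by (simp add: commute_on_def)
qed

text \<open>On \<open>\<Omega>\<close> the operator \<open>U\<close> is a finite sum against its
  kernel, so it acts on the exponential series term by term.\<close>

lemma commute_on_exp_op:
  assumes "lin_op \<Omega> T" "lin_op \<Omega> U" "commute_on \<Omega> U T"
  shows "commute_on \<Omega> U (exp_op T t)"
  unfolding commute_on_def
proof (intro allI ballI)
  fix f x assume x: "x \<in> \<Omega>"
  obtain K where K: "\<And>f x. x \<in> \<Omega> \<Longrightarrow> U f x = (\<Sum>y\<in>\<Omega>. K x y * f y)"
    using assms(2) unfolding lin_op_def by blast
  have "U (exp_op T t f) x = (\<Sum>y\<in>\<Omega>. \<Sum>k. K x y * (t ^ k / fact k * (T ^^ k) f y))"
    unfolding K[OF x] exp_op_def by (intro sum.cong refl suminf_mult[symmetric] exp_op_summable assms)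
  also have "\<dots> = (\<Sum>k. \<Sum>y\<in>\<Omega>. K x y * (t ^ k / fact k * (T ^^ k) f y))"
    by (intro suminf_sum[symmetric] summable_mult exp_op_summable assms)
  also have "\<dots> = (\<Sum>k. t ^ k / fact k * U ((T ^^ k) f) x)"
    unfolding K[OF x] by (simp add: sum_distrib_left mult_ac)
  also have "\<dots> = exp_op T t (U f) x"
    using commute_on_funpow[OF assms(1,3)] x by (simp add: exp_op_def commute_on_def)
  finally show "U (exp_op T t f) x = exp_op T t (U f) x" .
qed

lemma exp_op_has_derivative:
  assumes "lin_op \<Omega> T" "x \<in> \<Omega>"
  shows "((\<lambda>t. exp_op T t f x) has_real_derivative T (exp_op T t f) x) (at t)"
proof -
  define a where "a k = (T ^^ k) f x / fact k" for k
  have s: "summable (\<lambda>k. a k * t ^ k)" for t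
    using exp_op_summable[OF assms, of t f] by (simp add: a_def mult.commute)
  have "((\<lambda>t. \<Sum>k. a k * t ^ k) has_real_derivative (\<Sum>k. diffs a k * t ^ k)) (at t)"
    by (rule termdiffs_strong_converges_everywhere) (rule s)
  moreover have "(\<lambda>t. \<Sum>k. a k * t ^ k) = (\<lambda>t. exp_op T t f x)"
    by (simp add: a_def exp_op_def mult.commute)
  \<comment> \<open>Termwise differentiation turns the k-th coefficient into
    \<open>(T ^^ Suc k) f x / fact k\<close>. The extra \<open>T\<close> first falls on
    \<open>f\<close>, and is then moved outside because \<open>T\<close> commutes with its own
    exponential.\<close>
  moreover have "diffs a k * t ^ k = t ^ k / fact k * (T ^^ k) (T f) x" for k
    by (simp add: diffs_def a_def funpow_swap1 del: of_nat_Suc)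
  then have "(\<Sum>k. diffs a k * t ^ k) = exp_op T t (T f) x"
    by (simp add: exp_op_def)
  moreover have "T (exp_op T t f) x = exp_op T t (T f) x"
    using commute_on_exp_op[OF assms(1) assms(1), of t] assms(2) by (simp add: commute_on_def)
  ultimately show ?thesis by simp
qed

text \<open>Interpolation between two semigroups: the times \<open>s\<close> and
  \<open>t - s\<close> run in opposite directions, so the product rule leaves a difference of the
  two generators.\<close>

lemma ip_exp_op_has_derivative:
  assumes "lin_op \<Omega> A" "lin_op \<Omega> B"
  shows "((\<lambda>s. ip \<Omega> (exp_op A s f) (exp_op B (t - s) g)) has_real_derivative
    (ip \<Omega> (A (exp_op A s f)) (exp_op B (t - s) g) - ip \<Omega> (exp_op A s f) (B (exp_op B (t - s) g))))
    (at s)"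
proof -
  have B: "((\<lambda>s. exp_op B (t - s) g x) has_real_derivative - B (exp_op B (t - s) g) x) (at s)"
    if "x \<in> \<Omega>" for x
  proof -
    have "((\<lambda>s. t - s) has_real_derivative - 1) (at s)"
      by (auto intro!: derivative_eq_intros)
    from DERIV_chain2[OF exp_op_has_derivative[OF assms(2) that] this]
    show ?thesis by simp
  qed
  have "((\<lambda>s. ip \<Omega> (exp_op A s f) (exp_op B (t - s) g)) has_real_derivative
    (\<Sum>x\<in>\<Omega>. A (exp_op A s f) x * exp_op B (t - s) g x
      + (- B (exp_op B (t - s) g) x) * exp_op A s f x)) (at s)"
    unfolding ip_def by (intro DERIV_sum DERIV_mult exp_op_has_derivative[OF assms(1)] B)
  then show ?thesis
    by (simp add: ip_def sum.distrib sum_negf sum_subtractf mult.commute)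
qed

text \<open>Symmetry and the semigroup law at once: interpolating between \<open>T\<close> and
  itself has derivative 0 by symmetry, so the values at \<open>s\<close> and at 0 agree.\<close>

lemma ip_exp_op:
  assumes "sym_op \<Omega> T"
  shows "ip \<Omega> (exp_op T s f) (exp_op T t g) = ip \<Omega> f (exp_op T (s + t) g)"
proof -
  have T: "lin_op \<Omega> T" "\<And>f g. ip \<Omega> (T f) g = ip \<Omega> f (T g)"
    using assms by (auto simp: sym_op_def)
  define \<phi> where "\<phi> r = ip \<Omega> (exp_op T r f) (exp_op T (s + t - r) g)" for r
  have "(\<phi> has_real_derivative 0) (at r)" for r
    using ip_exp_op_has_derivative[OF T(1) T(1), where s = r and t = "s + t"]
    unfolding \<phi>_def T(2) by simp
  then have "\<phi> s = \<phi> 0" by (intro DERIV_isconst_all) auto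
  then show ?thesis by (simp add: \<phi>_def)
qed

lemma sym_op_exp_op: "sym_op \<Omega> T \<Longrightarrow> sym_op \<Omega> (exp_op T t)"
  using ip_exp_op[where t = 0] lin_op_exp_op by (simp add: sym_op_def)

lemma ip_exp_op_half:
  assumes "sym_op \<Omega> T"
  shows "ip \<Omega> (exp_op T (t / 2) f) (exp_op T (t / 2) f) = ip \<Omega> f (exp_op T t f)"
  using ip_exp_op[OF assms, of "t / 2" f "t / 2" f] by simp

text \<open>The form is a squared norm at half the time.\<close>

lemma ip_exp_op_nonneg: "sym_op \<Omega> T \<Longrightarrow> 0 \<le> ip \<Omega> f (exp_op T t f)"
  using ip_self_nonneg[of \<Omega> "exp_op T (t / 2) f"] by (simp add: ip_exp_op_half)

text \<open>Log-convexity of \<open>t \<mapsto> \<langle>f, e\<^sup>t\<^sup>T f\<rangle>\<close>, at the midpoint of \<open>0\<close> and \<open>t\<close>.\<close>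

lemma ip_exp_op_half_square:
  assumes "sym_op \<Omega> T"
  shows "(ip \<Omega> f (exp_op T (t / 2) f))\<^sup>2 \<le> ip \<Omega> f f * ip \<Omega> f (exp_op T t f)"
  using ip_square[of \<Omega> f "exp_op T (t / 2) f"] by (simp add: ip_exp_op_half[OF assms])

text \<open>
  The function \<open>s \<mapsto> \<langle>e\<^sup>s\<^sup>A f, e\<^bsup>(t-s)B\<^esup> f\<rangle>\<close> has derivative \<open>\<langle>h, (A - B) h\<rangle>\<close> at \<open>s\<close>, where
  \<open>h = e\<^bsup>sA/2\<^esup> e\<^bsup>(t-s)B/2\<^esup> f\<close>. For non-commuting operators the conclusion fails in general.
\<close>

lemma ip_exp_op_mono:
  assumes A: "sym_op \<Omega> A" and B: "sym_op \<Omega> B" and AB: "commute_on \<Omega> A B"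
    and le: "\<And>h. ip \<Omega> h (B h) \<le> ip \<Omega> h (A h)" and t: "0 \<le> t"
  shows "ip \<Omega> f (exp_op B t f) \<le> ip \<Omega> f (exp_op A t f)"
proof -
  have lin: "lin_op \<Omega> A" "lin_op \<Omega> B" using A B by (auto simp: sym_op_def)
  define \<phi> where "\<phi> s = ip \<Omega> (exp_op A s f) (exp_op B (t - s) f)" for s
  have BA: "commute_on \<Omega> B A" using AB by (simp add: commute_on_def)
  have AA: "commute_on \<Omega> A A" and BB: "commute_on \<Omega> B B" by (simp_all add: commute_on_def)
  note lA = lin_op_exp_op[OF lin(1)]
  \<comment> \<open>Moving half of each exponential across the inner product gives
    \<open>\<langle>h, C h\<rangle>\<close> with the same \<open>h\<close> for \<open>C = A\<close>
    and for \<open>C = B\<close>, which is what \<open>le\<close> compares.\<close>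
  have half: "ip \<Omega> (exp_op A s f) (C (exp_op B r f)) =
      ip \<Omega> (exp_op A (s/2) (exp_op B (r/2) f)) (C (exp_op A (s/2) (exp_op B (r/2) f)))"
    if C: "lin_op \<Omega> C" "commute_on \<Omega> C A" "commute_on \<Omega> C B" "sym_op \<Omega> C" for C s r
  proof -
    define a b where "a = exp_op A (s/2)" and "b = exp_op B (r/2)"
    have sa: "sym_op \<Omega> a" and sb: "sym_op \<Omega> b"
      unfolding a_def b_def by (auto intro: sym_op_exp_op A B)
    have symD: "ip \<Omega> (T u) v = ip \<Omega> u (T v)" if "sym_op \<Omega> T" for T u v
      using that by (simp add: sym_op_def)
    have Ca: "C (a u) x = a (C u) x" if "x \<in> \<Omega>" for u x
      using commute_on_exp_op[OF lin(1) C(1,2), of "s/2"] that by (simp add: a_def commute_on_def)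
    have Cb: "C (b u) x = b (C u) x" if "x \<in> \<Omega>" for u x
      using commute_on_exp_op[OF lin(2) C(1,3), of "r/2"] that by (simp add: b_def commute_on_def)
    have aa: "ip \<Omega> u (a (a v)) = ip \<Omega> u (exp_op A s v)" for u v
      using ip_exp_op[OF A, of "s/2" u "s/2" v] symD[OF sa, of u "a v"] by (simp add: a_def)
    have bb: "ip \<Omega> u (b (b v)) = ip \<Omega> u (exp_op B r v)" for u v
      using ip_exp_op[OF B, of "r/2" u "r/2" v] symD[OF sb, of u "b v"] by (simp add: b_def)
    \<comment> \<open>From the symmetric form, first the two halves \<open>a\<close> are joined into
      \<open>exp_op A s\<close>; the two halves \<open>b\<close> are joined in the second chain
      below.\<close>
    have "ip \<Omega> (a (b f)) (C (a (b f))) = ip \<Omega> (a (b f)) (a (C (b f)))"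
      by (rule ip_cong) (auto simp: Ca)
    also have "\<dots> = ip \<Omega> (C (b f)) (a (a (b f)))"
      by (simp add: symD[OF sa] ip_commute[of _ "a _" "C _"])
        (metis ip_commute symD[OF sa])
    also have "\<dots> = ip \<Omega> (C (b f)) (exp_op A s (b f))" by (rule aa)
    also have "\<dots> = ip \<Omega> (b (C f)) (exp_op A s (b f))"
      by (rule ip_cong) (auto simp: Cb)
    also have "\<dots> = ip \<Omega> (exp_op A s (b (C f))) (b f)"
      by (simp add: symD[OF sym_op_exp_op[OF A]])
    finally have 1: "ip \<Omega> (a (b f)) (C (a (b f))) = ip \<Omega> (exp_op A s (b (C f))) (b f)" .
    \<comment> \<open>Two passes to the exponential: \<open>B\<close> commutes with
      \<open>exp_op A s\<close>, hence \<open>exp_op A s\<close> commutes with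
      \<open>b\<close>.\<close>
    have "commute_on \<Omega> B (exp_op A s)"
      by (rule commute_on_exp_op[OF lin(1) lin(2) BA])
    then have "commute_on \<Omega> (exp_op A s) B" by (simp add: commute_on_def)
    then have Ab: "exp_op A s (b u) x = b (exp_op A s u) x" if "x \<in> \<Omega>" for u x
      using commute_on_exp_op[OF lin(2) lA, of s "r/2"] that by (simp add: b_def commute_on_def)
    have "commute_on \<Omega> C (exp_op A s)"
      by (rule commute_on_exp_op[OF lin(1) C(1,2)])
    then have CA: "exp_op A s (C u) x = C (exp_op A s u) x"
      if "x \<in> \<Omega>" for u x using that by (auto simp: commute_on_def)
    have "ip \<Omega> (exp_op A s (b (C f))) (b f) = ip \<Omega> (b (exp_op A s (C f))) (b f)"
      by (rule ip_cong) (auto simp: Ab)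
    also have "\<dots> = ip \<Omega> (exp_op A s (C f)) (b (b f))" by (rule symD[OF sb])
    also have "\<dots> = ip \<Omega> (exp_op A s (C f)) (exp_op B r f)" by (rule bb)
    also have "\<dots> = ip \<Omega> (C (exp_op A s f)) (exp_op B r f)"
      by (rule ip_cong) (auto simp: CA)
    also have "\<dots> = ip \<Omega> (exp_op A s f) (C (exp_op B r f))" by (rule symD[OF C(4)])
    finally show ?thesis using 1 by (simp add: a_def b_def)
  qed
  have "\<exists>d. (\<phi> has_real_derivative d) (at s) \<and> 0 \<le> d" for s
  proof -
    have "ip \<Omega> (exp_op A s f) (B (exp_op B (t - s) f)) \<le> ip \<Omega> (exp_op A s f) (A (exp_op B (t - s) f))"
      using le half[OF lin(2) BA BB B] half[OF lin(1) AA AB A] by simp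
    also have "\<dots> = ip \<Omega> (A (exp_op A s f)) (exp_op B (t - s) f)"
      using A by (simp add: sym_op_def)
    finally show ?thesis
      using ip_exp_op_has_derivative[OF lin, of f t f s] unfolding \<phi>_def by (intro exI conjI) auto
  qed
  then have "\<phi> 0 \<le> \<phi> t" using DERIV_nonneg_imp_nondecreasing[OF t] by blast
  \<comment> \<open>The endpoints of \<open>\<phi>\<close> are the two sides of the claim.\<close>
  then show ?thesis
    using ip_exp_op[OF A, of t f 0 f] by (simp add: \<phi>_def)
qed

end

section \<open>The exclusion generator\<close>

lemma interchange_doubleton:
  assumes "u \<noteq> v"
  shows "interchange {u, v} x = x \<circ> Transposition.transpose u v"
proof
  fix w
  show "interchange {u, v} x w = (x \<circ> Transposition.transpose u v) w"
    using assms assms[symmetric]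
    by (cases "w = u"; cases "w = v") (simp_all add: interchange_def insert_Diff_if)
qed

lemma interchange_invol: "card e = 2 \<Longrightarrow> interchange e (interchange e x) = x"
  by (auto simp: card_2_iff interchange_doubleton comp_assoc)

text \<open>The conjugation rule for transpositions. Interchanges act by composition on the right,
  so the outermost interchange is the rightmost transposition.\<close>

lemma interchange_image:
  assumes "card e = 2" "a \<noteq> b"
  shows "interchange {a, b} (interchange (Transposition.transpose a b ` e) x)
    = interchange e (interchange {a, b} x)"
proof -
  obtain u v where e: "e = {u, v}" "u \<noteq> v" using assms(1) by (auto simp: card_2_iff)
  have ne: "Transposition.transpose a b u \<noteq> Transposition.transpose a b v"
    using e(2) by (metis transpose_involutory)
  have "Transposition.transpose (Transposition.transpose a b u) (Transposition.transpose a b v)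
      \<circ> Transposition.transpose a b = Transposition.transpose a b \<circ> Transposition.transpose u v"
    by (subst transpose_comp_eq) simp_all
  then show ?thesis
    using assms e ne by (simp add: interchange_doubleton comp_assoc)
qed

text \<open>Conjugation by the transposition of \<open>e\<close> maps \<open>V\<close> to itself and
  therefore permutes the complete edges. This is where completeness enters the commutation of the
  generators.\<close>

lemma sum_complete_edges_conjugate:
  assumes e: "e \<subseteq> V" "card e = 2"
  shows "(\<Sum>e'\<in>complete_edges V. g (interchange e (interchange e' x)))
    = (\<Sum>e'\<in>complete_edges V. g (interchange e' (interchange e x)))"
proof -
  obtain a b where ab: "e = {a, b}" "a \<noteq> b" using e(2) by (auto simp: card_2_iff)
  let ?\<tau> = "Transposition.transpose a b"
  have im: "?\<tau> ` e' \<in> complete_edges V" if "e' \<in> complete_edges V" for e'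
  proof -
    have "?\<tau> ` e' \<subseteq> ?\<tau> ` V" using that by (intro image_mono) (simp add: complete_edges_def)
    also have "?\<tau> ` V = V" using e ab by simp
    finally show ?thesis using that by (simp add: complete_edges_def card_image)
  qed
  have inv: "?\<tau> ` ?\<tau> ` e' = e'" for e' by (simp add: image_comp)
  have conj: "interchange e (interchange e' x) = interchange (?\<tau> ` e') (interchange e x)"
    if "e' \<in> complete_edges V" for e'
    using interchange_image[of "?\<tau> ` e'" a b x] im[OF that] ab by (simp add: complete_edges_def inv)
  show ?thesis
    by (rule sum.reindex_bij_witness[where i = "(`) ?\<tau>" and j = "(`) ?\<tau>"])
      (simp_all only: im inv conj)
qed

lemma excl_gen_commute:
  assumes "E \<subseteq> complete_edges V"
  shows "excl_gen E \<alpha> (excl_gen (complete_edges V) \<beta> f)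
    = excl_gen (complete_edges V) \<beta> (excl_gen E \<alpha> f)"
proof
  fix x
  let ?K = "complete_edges V"
  have "excl_jump E \<alpha> (excl_jump ?K \<beta> f) x
      = \<alpha> * \<beta> * (\<Sum>e\<in>E. \<Sum>e'\<in>?K. f (interchange e' (interchange e x)))"
    by (simp add: excl_jump_def sum_distrib_left mult_ac)
  also have "\<dots> = \<alpha> * \<beta> * (\<Sum>e\<in>E. \<Sum>e'\<in>?K. f (interchange e (interchange e' x)))"
    using assms by (intro arg_cong[where f = "(*) _"] sum.cong refl sum_complete_edges_conjugate[symmetric])
      (auto simp: complete_edges_def)
  also have "\<dots> = excl_jump ?K \<beta> (excl_jump E \<alpha> f) x"
    by (subst sum.swap) (simp add: excl_jump_def sum_distrib_left mult_ac)
  finally have J: "excl_jump E \<alpha> (excl_jump ?K \<beta> f) x = excl_jump ?K \<beta> (excl_jump E \<alpha> f) x" .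
  have lin: "excl_jump F \<gamma> (\<lambda>y. g y + c * h y) x = excl_jump F \<gamma> g x + c * excl_jump F \<gamma> h x"
    for F :: "'a set set" and \<gamma> g c h
    by (simp add: excl_jump_def sum.distrib sum_distrib_left algebra_simps)
  \<comment> \<open>A generator is its jump part minus a multiple of the identity, so commuting jump
    parts suffice.\<close>
  have *: "excl_gen F \<gamma> g = (\<lambda>y. excl_jump F \<gamma> g y + (- (\<gamma> * card F)) * g y)"
    for F :: "'a set set" and \<gamma> g by (rule ext) (rule excl_gen_jump)
  show "excl_gen E \<alpha> (excl_gen ?K \<beta> f) x = excl_gen ?K \<beta> (excl_gen E \<alpha> f) x"
    unfolding * lin J by (simp add: algebra_simps)
qed

section \<open>Reversibility and the Dirichlet form\<close>

context
  fixes V :: "'v set" and E :: "'v set set"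
  assumes G: "simple_graph V E"
begin

lemma finV: "finite V" and finE: "finite E" and edges: "E \<subseteq> complete_edges V"
  using G finite_subset[of E "Pow V"] by (auto simp: simple_graph_def complete_edges_def)

text \<open>Makes every fact about \<open>E\<close> in this context available for the complete graph
  too.\<close>

lemma simple_complete: "simple_graph V (complete_edges V)"
  using G by (auto simp: simple_graph_def complete_edges_def)

lemma lin_op_excl_gen: "lin_op (configs V) (excl_gen E \<alpha>)"
proof -
  define K where "K x y = \<alpha> * (\<Sum>e\<in>E. of_bool (interchange e x = y) - of_bool (x = y))"
    for x y :: "'v \<Rightarrow> nat"
  have pick: "(\<Sum>y\<in>configs V. of_bool (z = y) * f y) = f z" if "z \<in> configs V"
    for f :: "('v \<Rightarrow> nat) \<Rightarrow> real" and z
    using that finite_configs[OF finV]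
    by (simp add: of_bool_def if_distrib[where f = "\<lambda>a. a * _"] cong: if_cong)
  have "excl_gen E \<alpha> f x = (\<Sum>y\<in>configs V. K x y * f y)" if x: "x \<in> configs V" for f x
  proof -
    have "(\<Sum>y\<in>configs V. K x y * f y)
        = \<alpha> * (\<Sum>e\<in>E. (\<Sum>y\<in>configs V. of_bool (interchange e x = y) * f y)
            - (\<Sum>y\<in>configs V. of_bool (x = y) * f y))"
      by (simp add: K_def sum_distrib_left sum_distrib_right sum.swap[of _ "configs V" E]
          algebra_simps sum_subtractf)
    also have "\<dots> = \<alpha> * (\<Sum>e\<in>E. f (interchange e x) - f x)"
      using edges x
      by (intro arg_cong[where f = "(*) _"] sum.cong refl arg_cong2[where f = "(-)"] pick)
        (auto simp: complete_edges_def intro!: interchange_in_configs)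
    finally show ?thesis by (simp add: excl_gen_def)
  qed
  then show ?thesis by (rule lin_opI)
qed

text \<open>Reversibility of the uniform measure, edge by edge: \<open>interchange e\<close> is an
  involution of the configurations and serves as a change of variables.\<close>

lemma sum_interchange:
  assumes "e \<in> E"
  shows "(\<Sum>x\<in>configs V. g (interchange e x) x) = (\<Sum>x\<in>configs V. g x (interchange e x))"
proof -
  have e: "e \<subseteq> V" "card e = 2" using assms edges by (auto simp: complete_edges_def)
  show ?thesis
    by (rule sum.reindex_bij_witness[where i = "interchange e" and j = "interchange e"])
      (auto simp: interchange_invol[OF e(2)] interchange_in_configs[OF e])
qed

lemma ip_excl_gen:
  "ip (configs V) f (excl_gen E \<alpha> g)
    = \<alpha> * (\<Sum>e\<in>E. \<Sum>x\<in>configs V. f x * (g (interchange e x) - g x))"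
  unfolding ip_def excl_gen_def
  by (simp add: sum_distrib_left sum.swap[of _ "configs V" E] mult_ac)

lemma sym_op_excl_gen: "sym_op (configs V) (excl_gen E \<alpha>)"
proof -
  have "(\<Sum>x\<in>configs V. f x * (g (interchange e x) - g x))
      = (\<Sum>x\<in>configs V. g x * (f (interchange e x) - f x))" if "e \<in> E"
    for e and f g :: "('v \<Rightarrow> nat) \<Rightarrow> real"
  proof -
    have "(\<Sum>x\<in>configs V. f x * g (interchange e x)) = (\<Sum>x\<in>configs V. g x * f (interchange e x))"
      using sum_interchange[OF that, of "\<lambda>y x. f x * g y"] by (simp add: mult.commute[of "f _"])
    moreover have "(\<Sum>x\<in>configs V. f x * g x) = (\<Sum>x\<in>configs V. g x * f x)"
      by (simp add: mult.commute)
    ultimately show ?thesis by (simp only: right_diff_distrib sum_subtractf)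
  qed
  then have "ip (configs V) (excl_gen E \<alpha> f) g = ip (configs V) f (excl_gen E \<alpha> g)" for f g
    by (simp add: ip_excl_gen ip_commute[of _ "excl_gen E \<alpha> f"] cong: sum.cong)
  then show ?thesis using lin_op_excl_gen by (simp add: sym_op_def)
qed

lemma dirichlet_form:
  "ip (configs V) h (excl_gen E \<alpha> h)
    = - (\<alpha> / 2) * (\<Sum>e\<in>E. \<Sum>x\<in>configs V. (h (interchange e x) - h x)\<^sup>2)"
proof -
  have "(\<Sum>x\<in>configs V. (h (interchange e x) - h x)\<^sup>2)
      = - 2 * (\<Sum>x\<in>configs V. h x * (h (interchange e x) - h x))" if "e \<in> E" for e
  proof -
    \<comment> \<open>Expanding the square leaves a difference of two sums of squares of
      \<open>h\<close>, which vanishes by the change of variables.\<close>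
    have "(\<Sum>x\<in>configs V. (h (interchange e x) - h x)\<^sup>2) + 2 * (\<Sum>x\<in>configs V. h x * (h (interchange e x) - h x))
       = (\<Sum>x\<in>configs V. (h (interchange e x))\<^sup>2) - (\<Sum>x\<in>configs V. (h x)\<^sup>2)"
      unfolding sum_distrib_left sum.distrib[symmetric] sum_subtractf[symmetric]
      by (rule sum.cong) (auto simp: power2_eq_square algebra_simps)
    then show ?thesis using sum_interchange[OF that, of "\<lambda>y x. (h y)\<^sup>2"] by simp
  qed
  then show ?thesis by (simp add: ip_excl_gen sum_distrib_left cong: sum.cong)
qed


section \<open>Covariances and probabilities as quadratic forms of the semigroup\<close>

lemma excl_semigroup_eq_exp_op: "excl_semigroup E \<alpha> t = exp_op (excl_gen E \<alpha>) t"
  by (simp add: excl_semigroup_def exp_op_def fun_eq_iff)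

lemma excl_semigroup_eq_sum:
  "x \<in> configs V \<Longrightarrow> excl_semigroup E \<alpha> t f x = (\<Sum>y\<in>configs V. excl_trans E \<alpha> t x y * f y)"
  using exp_op_kernel[OF finite_configs[OF finV] lin_op_excl_gen]
  by (simp add: excl_semigroup_eq_exp_op excl_trans_def)

lemma sym_op_excl_semigroup: "sym_op (configs V) (excl_semigroup E \<alpha> t)"
  unfolding excl_semigroup_eq_exp_op
  by (rule sym_op_exp_op[OF finite_configs[OF finV] sym_op_excl_gen])

text \<open>Stationarity of the uniform measure: pair with the constant 1, use symmetry, and note
  that the semigroup fixes constants.\<close>

lemma sum_excl_semigroup:
  assumes "0 \<le> \<alpha>"
  shows "(\<Sum>x\<in>configs V. excl_semigroup E \<alpha> t f x) = (\<Sum>x\<in>configs V. f x)"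
proof -
  have "ip (configs V) (\<lambda>_. 1) (excl_semigroup E \<alpha> t f)
      = ip (configs V) (excl_semigroup E \<alpha> t (\<lambda>_. 1)) f"
    using sym_op_excl_semigroup by (simp add: sym_op_def)
  also have "\<dots> = ip (configs V) (\<lambda>_. 1) f"
    by (rule ip_cong) (simp_all add: excl_semigroup_eq_sum sum_excl_trans[OF G assms])
  finally show ?thesis by (simp add: ip_def)
qed

lemma integral_exclusion_law:
  assumes "0 \<le> \<alpha>" "0 \<le> t"
  shows "(\<integral>(x, y). F x y \<partial>exclusion_law V E \<alpha> t)
    = (\<Sum>x\<in>configs V. \<Sum>y\<in>configs V. excl_trans E \<alpha> t x y * F x y) / card (configs V)"
  unfolding exclusion_law_def case_prod_unfold
  by (subst lebesgue_integral_point_measure_finite)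
    (use finite_configs[OF finV] assms in \<open>auto simp: sum.cartesian_product case_prod_unfold sum_divide_distrib
        intro!: divide_nonneg_nonneg excl_trans_nonneg sum.cong\<close>)

lemma integral_exclusion_law_mult:
  assumes "0 \<le> \<alpha>" "0 \<le> t"
  shows "(\<integral>(x, y). f x * g y \<partial>exclusion_law V E \<alpha> t)
    = ip (configs V) f (excl_semigroup E \<alpha> t g) / card (configs V)"
  by (simp add: integral_exclusion_law[OF assms] ip_def excl_semigroup_eq_sum sum_distrib_left mult_ac
      cong: sum.cong)

lemma integral_exclusion_law_fst:
  assumes "0 \<le> \<alpha>" "0 \<le> t"
  shows "(\<integral>(x, y). f x \<partial>exclusion_law V E \<alpha> t) = (\<Sum>x\<in>configs V. f x) / card (configs V)"
  by (simp add: integral_exclusion_law[OF assms] sum_excl_trans[OF G assms(1)]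
      flip: sum_distrib_right cong: sum.cong)

lemma integral_exclusion_law_snd:
  assumes "0 \<le> \<alpha>" "0 \<le> t"
  shows "(\<integral>(x, y). f y \<partial>exclusion_law V E \<alpha> t) = (\<Sum>x\<in>configs V. f x) / card (configs V)"
  using integral_exclusion_law_mult[OF assms, of "\<lambda>_. 1" f] sum_excl_semigroup[OF assms(1), of t f]
  by (simp add: ip_def)

text \<open>The semigroup fixes constants and preserves sums, so centring \<open>f\<close> absorbs
  the product of the means. What remains is one quadratic form, to which positivity, comparison and
  log-convexity apply.\<close>

lemma covariance_exclusion_law:
  fixes f :: "('v \<Rightarrow> nat) \<Rightarrow> real"
  assumes "0 \<le> \<alpha>" "0 \<le> t"
  defines "m \<equiv> (\<Sum>x\<in>configs V. f x) / card (configs V)"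
  shows "covariance (exclusion_law V E \<alpha> t) (\<lambda>(x, y). f x) (\<lambda>(x, y). f y)
    = ip (configs V) (\<lambda>x. f x - m) (excl_semigroup E \<alpha> t (\<lambda>x. f x - m)) / card (configs V)"
proof -
  let ?N = "real (card (configs V))" and ?S = "excl_semigroup E \<alpha> t"
  have N: "?N > 0" using finite_configs[OF finV] configs_nonempty[of V] by (simp add: card_gt_0_iff)
  have sum: "(\<Sum>x\<in>configs V. f x) = ?N * m" using N by (simp add: m_def)
  have "?S (\<lambda>x. f x - m) x = ?S f x - m" if "x \<in> configs V" for x
    using that sum_excl_trans[OF G assms(1) that, of t]
    by (simp add: excl_semigroup_eq_sum right_diff_distrib sum_subtractf flip: sum_distrib_right)
  note S = this
  have "ip (configs V) (\<lambda>x. f x - m) (?S (\<lambda>x. f x - m))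
      = (\<Sum>x\<in>configs V. f x * ?S f x - m * f x - m * ?S f x + m * m)"
    unfolding ip_def by (intro sum.cong refl) (simp only: S, simp add: algebra_simps)
  also have "\<dots> = ip (configs V) f (?S f) - ?N * m * m"
    by (simp add: sum.distrib sum_subtractf sum_excl_semigroup[OF assms(1)] sum ip_def
        flip: sum_distrib_left)
  finally show ?thesis
    using N by (simp add: covariance_def case_prod_beta' diff_divide_distrib
        integral_exclusion_law_mult[OF assms(1,2), unfolded case_prod_beta']
        integral_exclusion_law_fst[OF assms(1,2), unfolded case_prod_beta']
        integral_exclusion_law_snd[OF assms(1,2), unfolded case_prod_beta'] sum)
qed

lemma prob_exclusion_law_neq:
  assumes "0 \<le> \<alpha>" "0 \<le> t" and f: "f \<in> configs V \<rightarrow> {0, 1}"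
  shows "\<P>((x, y) in exclusion_law V E \<alpha> t. f x \<noteq> f y)
    = 2 * (ip (configs V) f f - ip (configs V) f (excl_semigroup E \<alpha> t f)) / card (configs V)"
proof -
  let ?M = "exclusion_law V E \<alpha> t" and ?N = "real (card (configs V))"
  have sp: "space ?M = configs V \<times> configs V"
    by (simp add: exclusion_law_def space_point_measure)
  have "\<P>((x, y) in ?M. f x \<noteq> f y)
      = (\<integral>z. indicator {z \<in> space ?M. case z of (x, y) \<Rightarrow> f x \<noteq> f y} z \<partial>?M)"
    by (subst Bochner_Integration.integral_indicator) (auto intro: arg_cong[where f = "measure ?M"])
  \<comment> \<open>For values in \<open>{0, 1}\<close> the indicator of disagreement is this
    polynomial. Both marginals are uniform, so its linear terms have equal integrals.\<close>
  also have "\<dots> = (\<integral>z. (case z of (x, y) \<Rightarrow> f x + f y - 2 * (f x * f y)) \<partial>?M)"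
  proof (rule Bochner_Integration.integral_cong)
    fix z assume "z \<in> space ?M"
    then obtain x y where z: "z = (x, y)" "x \<in> configs V" "y \<in> configs V" by (auto simp: sp)
    then have "f x \<in> {0, 1}" "f y \<in> {0, 1}" using f by auto
    then show "indicator {z \<in> space ?M. case z of (x, y) \<Rightarrow> f x \<noteq> f y} z
        = (case z of (x, y) \<Rightarrow> f x + f y - 2 * (f x * f y))"
      using z by (auto simp: sp)
  qed simp
  also have "\<dots> = (\<integral>(x, y). f x \<partial>?M) + (\<integral>(x, y). f y \<partial>?M) - 2 * (\<integral>(x, y). f x * f y \<partial>?M)"
    by (simp add: integral_exclusion_law[OF assms(1,2)] sum.distrib sum_subtractf algebra_simps
        sum_distrib_left add_divide_distrib diff_divide_distrib)
  also have "\<dots> = (2 * (\<Sum>x\<in>configs V. f x) - 2 * ip (configs V) f (excl_semigroup E \<alpha> t f)) / ?N"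
    by (simp add: integral_exclusion_law_fst[OF assms(1,2)] integral_exclusion_law_snd[OF assms(1,2)]
        integral_exclusion_law_mult[OF assms(1,2)] diff_divide_distrib)
  also have "(\<Sum>x\<in>configs V. f x) = ip (configs V) f f"
    unfolding ip_def by (rule sum.cong) (use f in auto)
  finally show ?thesis by (simp add: algebra_simps)
qed

end

section \<open>Comparison with the complete graph\<close>

text \<open>The share of one edge in the Dirichlet form, up to the factor
  \<open>- (\<alpha> / 2)\<close>.\<close>

definition edge_energy :: "'v set \<Rightarrow> (('v \<Rightarrow> nat) \<Rightarrow> real) \<Rightarrow> 'v set \<Rightarrow> real" where
  "edge_energy V h e = (\<Sum>x\<in>configs V. (h (interchange e x) - h x)\<^sup>2)"

lemma edge_energy_nonneg: "0 \<le> edge_energy V h e"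
  by (simp add: edge_energy_def sum_nonneg)

lemma excl_gen_scale: "excl_gen E (c * \<alpha>) f x = c * excl_gen E \<alpha> f x"
  by (simp add: excl_gen_def)

lemma excl_gen_mult: "excl_gen E \<alpha> (\<lambda>x. c * f x) x = c * excl_gen E \<alpha> f x"
  by (simp add: excl_gen_def sum_distrib_left algebra_simps)

lemma excl_gen_power_scale:
  "(excl_gen E (c * \<alpha>) ^^ k) f x = c ^ k * (excl_gen E \<alpha> ^^ k) f x"
proof (induction k arbitrary: x)
  case 0
  then show ?case by simp
next
  case (Suc k)
  then have "(excl_gen E (c * \<alpha>) ^^ k) f = (\<lambda>x. c ^ k * (excl_gen E \<alpha> ^^ k) f x)" by auto
  then show ?case
    by (simp add: excl_gen_mult excl_gen_scale[of E c \<alpha> "(excl_gen E \<alpha> ^^ k) f"])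
qed

text \<open>The generator is linear in the rate, so a constant factor can be moved between rate and
  time.\<close>

lemma excl_semigroup_scale: "excl_semigroup E (c * \<alpha>) t = excl_semigroup E \<alpha> (c * t)"
  unfolding excl_semigroup_def excl_gen_power_scale power_mult_distrib
  by (simp add: fun_eq_iff mult_ac)

section \<open>Comparison of Dirichlet forms\<close>

context
  fixes V :: "'v set" and E :: "'v set set"
  assumes G: "simple_graph V E"
begin

text \<open>Swapping \<open>u\<close> and \<open>v\<close> takes three interchanges:
  \<open>{u, w}\<close>, \<open>{v, w}\<close>, \<open>{u, w}\<close>. The square of a sum of three
  increments is at most three times the sum of their squares, and each increment is evaluated at a
  uniform configuration.\<close>

lemma edge_energy_triangle:
  assumes V: "u \<in> V" "v \<in> V" "w \<in> V" and ne: "u \<noteq> v" "u \<noteq> w" "v \<noteq> w"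
  shows "edge_energy V h {u, v} \<le> 6 * (edge_energy V h {u, w} + edge_energy V h {v, w})"
proof -
  define p q where "p = interchange {u, w}" and "q = interchange {v, w}"
  have shift: "(\<Sum>x\<in>configs V. g (interchange e x)) = (\<Sum>x\<in>configs V. g x)"
    if "e \<in> complete_edges V" for g :: "_ \<Rightarrow> real" and e
    using sum_interchange[OF simple_complete[OF G] that, of "\<lambda>y x. g y"] by simp
  have e: "{u, w} \<in> complete_edges V" "{v, w} \<in> complete_edges V"
    using V ne by (auto simp: complete_edges_def)
  have "interchange {u, v} x = p (q (p x))" for x
    using ne by (auto simp: p_def q_def interchange_doubleton fun_eq_iff Transposition.transpose_def)
  then have "edge_energy V h {u, v} = (\<Sum>x\<in>configs V. (h (p (q (p x))) - h x)\<^sup>2)"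
    by (simp add: edge_energy_def)
  also have "\<dots> \<le> (\<Sum>x\<in>configs V. 3 * ((h (p (q (p x))) - h (q (p x)))\<^sup>2
      + (h (q (p x)) - h (p x))\<^sup>2 + (h (p x) - h x)\<^sup>2))"
  proof (rule sum_mono)
    fix x
    have "(a + b + c)\<^sup>2 \<le> 3 * (a\<^sup>2 + b\<^sup>2 + c\<^sup>2)" for a b c :: real
      using zero_le_power2[of "a - b"] zero_le_power2[of "b - c"] zero_le_power2[of "a - c"]
      by (simp add: power2_eq_square algebra_simps)
    from this[of "h (p (q (p x))) - h (q (p x))" "h (q (p x)) - h (p x)" "h (p x) - h x"]
    show "(h (p (q (p x))) - h x)\<^sup>2 \<le> 3 * ((h (p (q (p x))) - h (q (p x)))\<^sup>2
      + (h (q (p x)) - h (p x))\<^sup>2 + (h (p x) - h x)\<^sup>2)" by simp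
  qed
  also have "\<dots> = 3 * ((\<Sum>x\<in>configs V. (h (p (q (p x))) - h (q (p x)))\<^sup>2)
      + (\<Sum>x\<in>configs V. (h (q (p x)) - h (p x))\<^sup>2) + (\<Sum>x\<in>configs V. (h (p x) - h x)\<^sup>2))"
    by (simp add: sum.distrib flip: sum_distrib_left)
  \<comment> \<open>Two changes of variables remove the inner \<open>p\<close> and then
    \<open>q\<close>.\<close>
  also have "(\<Sum>x\<in>configs V. (h (p (q (p x))) - h (q (p x)))\<^sup>2) = edge_energy V h {u, w}"
    using shift[OF e(1), of "\<lambda>x. (h (p (q x)) - h (q x))\<^sup>2"] shift[OF e(2), of "\<lambda>x. (h (p x) - h x)\<^sup>2"]
    by (simp add: edge_energy_def p_def q_def)
  also have "(\<Sum>x\<in>configs V. (h (q (p x)) - h (p x))\<^sup>2) = edge_energy V h {v, w}"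
    using shift[OF e(1), of "\<lambda>x. (h (q x) - h x)\<^sup>2"] by (simp add: edge_energy_def p_def q_def)
  also have "(\<Sum>x\<in>configs V. (h (p x) - h x)\<^sup>2) = edge_energy V h {u, w}"
    by (simp add: edge_energy_def p_def)
  \<comment> \<open>The bound reached is 6 times the energy of \<open>{u, w}\<close> plus 3 times
    that of \<open>{v, w}\<close>; the 3 is raised to 6 for symmetry.\<close>
  finally show ?thesis using edge_energy_nonneg[of V h "{v, w}"] by simp
qed

text \<open>Sum the triangle bound over all \<open>w\<close> in \<open>V\<close>:
  \<open>card V\<close> times the energy of an edge is at most 6 times the energies
  \<open>s u\<close> of the complete stars at its endpoints. Over \<open>E\<close>, each
  \<open>s u\<close> occurs degree-many times, and the \<open>s u\<close> add up to twice the total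
  energy, whence 12.\<close>

lemma edge_energy_sum_le:
  "card V * (\<Sum>e\<in>E. edge_energy V h e)
    \<le> 12 * max_degree V E * (\<Sum>e\<in>complete_edges V. edge_energy V h e)"
proof -
  let ?K = "complete_edges V" and ?D = "edge_energy V h"
  have fin: "finite V" "finite E" "finite ?K" and EK: "E \<subseteq> ?K"
    using finV[OF G] finE[OF G] edges[OF G] finE[OF simple_complete[OF G]] by auto
  define s where "s u = (\<Sum>e | e \<in> ?K \<and> u \<in> e. ?D e)" for u
  have s0: "0 \<le> s u" for u by (simp add: s_def sum_nonneg edge_energy_nonneg)
  have s: "s u = (\<Sum>w\<in>V - {u}. ?D {u, w})" if "u \<in> V" for u
    unfolding s_def
    by (rule sum.reindex_bij_witness[where i = "\<lambda>w. {u, w}" and j = "\<lambda>e. the_elem (e - {u})"])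
      (use that in \<open>auto simp: complete_edges_def card_2_iff insert_Diff_if insert_commute\<close>)
  have vs: "(\<Sum>u | u \<in> V \<and> u \<in> e. g u) = (\<Sum>u\<in>e. g u)" if "e \<in> ?K" for e and g :: "_ \<Rightarrow> real"
    using that by (intro sum.cong) (auto simp: complete_edges_def)
  have total: "(\<Sum>u\<in>V. s u) = 2 * (\<Sum>e\<in>?K. ?D e)"
  proof -
    have "(\<Sum>u\<in>V. s u) = (\<Sum>e\<in>?K. \<Sum>u | u \<in> V \<and> u \<in> e. ?D e)"
      unfolding s_def by (rule sum.swap_restrict[OF fin(1,3)])
    also have "\<dots> = (\<Sum>e\<in>?K. 2 * ?D e)"
      by (rule sum.cong[OF refl], subst vs) (auto simp: complete_edges_def)
    finally show ?thesis by (simp add: sum_distrib_left)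
  qed
  have edge: "card V * ?D e \<le> 6 * (\<Sum>u\<in>e. s u)" if "e \<in> E" for e
  proof -
    obtain u v where e: "e = {u, v}" "u \<noteq> v" "u \<in> V" "v \<in> V"
      using EK \<open>e \<in> E\<close> by (auto simp: complete_edges_def card_2_iff)
    \<comment> \<open>The value 0 on the diagonal lets \<open>w\<close> range over all of
      \<open>V\<close>. If \<open>w\<close> is an endpoint of \<open>e\<close>, the other term is
      the energy of \<open>e\<close> itself and the bound is trivial.\<close>
    define d where "d a w = (if w = a then 0 else ?D {a, w})" for a w
    have d: "(\<Sum>w\<in>V. d a w) = s a" if "a \<in> V" for a
      unfolding s[OF that] d_def using fin(1) that by (simp add: sum.If_cases Diff_eq Int_commute)
    have "?D e \<le> 6 * (d u w + d v w)" if "w \<in> V" for w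
      using edge_energy_triangle[OF e(3,4) that e(2), of h] e edge_energy_nonneg[of V h e]
      by (auto simp: d_def insert_commute)
    then have "card V * ?D e \<le> (\<Sum>w\<in>V. 6 * (d u w + d v w))"
      using sum_mono[of V "\<lambda>_. ?D e"] by simp
    also have "\<dots> = 6 * (s u + s v)"
      by (simp add: sum.distrib d e flip: sum_distrib_left)
    finally show ?thesis using e by simp
  qed
  have deg: "real (vdegree E u) \<le> max_degree V E" if "u \<in> V" for u
    unfolding max_degree_def using fin(1) that by simp
  have "card V * (\<Sum>e\<in>E. ?D e) \<le> (\<Sum>e\<in>E. 6 * (\<Sum>u\<in>e. s u))"
    unfolding sum_distrib_left[of "real (card V)"] by (rule sum_mono) (rule edge)
  also have "\<dots> = 6 * (\<Sum>e\<in>E. \<Sum>u | u \<in> V \<and> u \<in> e. s u)"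
    unfolding sum_distrib_left[symmetric]
    by (intro arg_cong[where f = "(*) 6"] sum.cong refl vs[symmetric]) (use EK in auto)
  also have "\<dots> = 6 * (\<Sum>u\<in>V. \<Sum>e | e \<in> E \<and> u \<in> e. s u)"
    by (subst sum.swap_restrict[OF fin(1,2), symmetric]) simp
  also have "\<dots> = 6 * (\<Sum>u\<in>V. vdegree E u * s u)"
    by (simp add: vdegree_def)
  also have "\<dots> \<le> 6 * (\<Sum>u\<in>V. max_degree V E * s u)"
    by (intro mult_left_mono sum_mono mult_right_mono deg s0) auto
  also have "\<dots> = 12 * max_degree V E * (\<Sum>e\<in>?K. ?D e)"
    by (simp add: total flip: sum_distrib_left)
  finally show ?thesis .
qed

text \<open>The constant \<open>12\<close> is rounded up to a power of two, which suits repeated halving of the time.\<close>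

lemma dirichlet_form_le_complete:
  fixes \<alpha> :: real
  assumes "0 \<le> \<alpha>" "\<alpha> * max_degree V E \<le> 1"
  shows "ip (configs V) h (excl_gen (complete_edges V) (16 * (1 / card V)) h)
    \<le> ip (configs V) h (excl_gen E \<alpha> h)"
proof -
  define a b where "a = (\<Sum>e\<in>E. edge_energy V h e)" and "b = (\<Sum>e\<in>complete_edges V. edge_energy V h e)"
  have n: "real (card V) > 0" using G by (simp add: simple_graph_def card_gt_0_iff)
  have b: "0 \<le> b" by (simp add: b_def sum_nonneg edge_energy_nonneg)
  have "\<alpha> * (card V * a) \<le> \<alpha> * (12 * max_degree V E * b)"
    using edge_energy_sum_le[of h] assms(1) unfolding a_def b_def by (rule mult_left_mono)
  also have "\<dots> = (\<alpha> * max_degree V E) * (12 * b)" by simp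
  also have "\<dots> \<le> 1 * (12 * b)" using assms(2) b by (intro mult_right_mono) auto
  finally have "\<alpha> * a * card V \<le> 16 * b" using b by (simp add: mult_ac)
  then have "\<alpha> * a \<le> 16 * b / card V" using n by (simp add: pos_le_divide_eq)
  \<comment> \<open>The Dirichlet forms carry a negative factor, which reverses the inequality
    between energies.\<close>
  then show ?thesis
    by (simp add: dirichlet_form[OF G] dirichlet_form[OF simple_complete[OF G]] a_def b_def
        edge_energy_def)
qed

section \<open>From Dirichlet forms to covariances and probabilities\<close>

lemma ip_excl_semigroup_complete_le:
  fixes \<alpha> :: real
  assumes "0 \<le> \<alpha>" "\<alpha> * max_degree V E \<le> 1" "0 \<le> t"
  shows "ip (configs V) f (excl_semigroup (complete_edges V) (1 / card V) (16 * t) f)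
    \<le> ip (configs V) f (excl_semigroup E \<alpha> t f)"
  \<comment> \<open>The factor 16 is moved from the time into the rate, so that both semigroups run
    for the same time \<open>t\<close> as the comparison requires.\<close>
  unfolding excl_semigroup_scale[symmetric] excl_semigroup_eq_exp_op[OF G]
    excl_semigroup_eq_exp_op[OF simple_complete[OF G]]
  by (rule ip_exp_op_mono)
    (use assms G in \<open>auto intro: finite_configs finV sym_op_excl_gen simple_complete
       dirichlet_form_le_complete simp del: times_divide_eq_right mult_1_right
       simp: commute_on_def excl_gen_commute[OF edges[OF G]]\<close>)

text \<open>Time 1 on the complete graph is compared with time 1/16 on \<open>E\<close>. Four
  halvings lead from 1 to 1/16, each squaring the bound by log-convexity, which gives the exponent
  16.\<close>

lemma covariance_complete_power_le:
  fixes f :: "('v \<Rightarrow> nat) \<Rightarrow> real" and \<alpha> :: real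
  assumes \<alpha>: "0 \<le> \<alpha>" "\<alpha> * max_degree V E \<le> 1" and f: "f \<in> configs V \<rightarrow> {0, 1}"
  defines "k \<equiv> covariance (exclusion_law V (complete_edges V) (1 / card V) 1)
      (\<lambda>(x, y). f x) (\<lambda>(x, y). f y)"
  shows "0 \<le> k"
    and "k ^ 16 \<le> covariance (exclusion_law V E \<alpha> 1) (\<lambda>(x, y). f x) (\<lambda>(x, y). f y)"
proof -
  let ?N = "real (card (configs V))"
  define m where "m = (\<Sum>x\<in>configs V. f x) / ?N"
  define g where "g = (\<lambda>x. f x - m)"
  define a where "a t = ip (configs V) g (excl_semigroup E \<alpha> t g) / ?N" for t
  have fin: "finite (configs V)" by (rule finite_configs[OF finV[OF G]])
  have N: "?N > 0" using fin configs_nonempty[of V] by (simp add: card_gt_0_iff)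
  have k: "k = ip (configs V) g (excl_semigroup (complete_edges V) (1 / card V) 1 g) / ?N"
    unfolding k_def g_def m_def by (rule covariance_exclusion_law[OF simple_complete[OF G]]) auto
  show k0: "0 \<le> k"
    unfolding k excl_semigroup_eq_exp_op[OF simple_complete[OF G]]
    by (intro divide_nonneg_nonneg ip_exp_op_nonneg fin sym_op_excl_gen[OF simple_complete[OF G]]) simp
  have a1: "a 1 = covariance (exclusion_law V E \<alpha> 1) (\<lambda>(x, y). f x) (\<lambda>(x, y). f y)"
    unfolding a_def g_def m_def
    by (rule covariance_exclusion_law[OF G \<alpha>(1), symmetric]) simp
  have "k \<le> a (1 / 16)"
    using ip_excl_semigroup_complete_le[OF \<alpha>, of "1 / 16" g] N unfolding k a_def
    by (simp add: divide_right_mono)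
  have f01: "0 \<le> f x \<and> f x \<le> 1" if "x \<in> configs V" for x
    using f that by (auto dest!: Pi_mem)
  have "0 \<le> (\<Sum>x\<in>configs V. f x)" "(\<Sum>x\<in>configs V. f x) \<le> ?N"
    using sum_mono[of "configs V" f "\<lambda>_. 1"] f01 by (auto simp: sum_nonneg)
  then have m: "0 \<le> m" "m \<le> 1" using N by (simp_all add: m_def)
  have "\<bar>g x\<bar> \<le> 1" if "x \<in> configs V" for x
    using f01[OF that] m by (simp add: g_def abs_le_iff)
  then have "g x * g x \<le> 1" if "x \<in> configs V" for x
    using that abs_square_le_1[of "g x"] by (simp add: power2_eq_square)
  then have gg: "ip (configs V) g g \<le> ?N"
    unfolding ip_def using sum_mono[of "configs V" "\<lambda>x. g x * g x" "\<lambda>_. 1"] by simp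
  have nonneg: "0 \<le> ip (configs V) g (excl_semigroup E \<alpha> t g)" for t
    unfolding excl_semigroup_eq_exp_op[OF G]
    by (rule ip_exp_op_nonneg[OF fin sym_op_excl_gen[OF G]])
  have half: "(a (t / 2))\<^sup>2 \<le> a t" for t
  proof -
    have "(ip (configs V) g (excl_semigroup E \<alpha> (t / 2) g))\<^sup>2
        \<le> ip (configs V) g g * ip (configs V) g (excl_semigroup E \<alpha> t g)"
      unfolding excl_semigroup_eq_exp_op[OF G]
      by (rule ip_exp_op_half_square[OF fin sym_op_excl_gen[OF G]])
    also have "\<dots> \<le> ?N * ip (configs V) g (excl_semigroup E \<alpha> t g)"
      by (intro mult_right_mono gg nonneg)
    finally have "(a (t / 2))\<^sup>2 \<le> ?N * ip (configs V) g (excl_semigroup E \<alpha> t g) / ?N\<^sup>2"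
      unfolding a_def power_divide by (rule divide_right_mono) simp
    then show ?thesis using N by (simp add: a_def power2_eq_square)
  qed
  have "k ^ 16 \<le> a (1 / 16) ^ 16" by (rule power_mono[OF \<open>k \<le> a (1 / 16)\<close> k0])
  also have "\<dots> = ((((a (1 / 16))\<^sup>2)\<^sup>2)\<^sup>2)\<^sup>2" by simp
  also have "\<dots> \<le> (((a (1 / 8))\<^sup>2)\<^sup>2)\<^sup>2"
    using half[of "1 / 8"] by (intro power_mono) auto
  also have "\<dots> \<le> ((a (1 / 4))\<^sup>2)\<^sup>2"
    using half[of "1 / 4"] by (intro power_mono) auto
  also have "\<dots> \<le> (a (1 / 2))\<^sup>2"
    using half[of "1 / 2"] by (intro power_mono) auto
  also have "\<dots> \<le> a 1" by (rule half)
  finally show "k ^ 16 \<le> covariance (exclusion_law V E \<alpha> 1) (\<lambda>(x, y). f x) (\<lambda>(x, y). f y)"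
    by (simp add: a1)
qed

text \<open>Both probabilities are the same decreasing affine function of their quadratic forms, as
  \<open>ip (configs V) f f\<close> does not depend on the edges.\<close>

lemma prob_neq_le_complete:
  fixes f :: "('v \<Rightarrow> nat) \<Rightarrow> real" and \<alpha> :: real
  assumes \<alpha>: "0 \<le> \<alpha>" "\<alpha> * max_degree V E \<le> 1" and f: "f \<in> configs V \<rightarrow> {0, 1}" and t: "0 \<le> t"
  shows "\<P>((x, y) in exclusion_law V E \<alpha> t. f x \<noteq> f y)
    \<le> \<P>((x, y) in exclusion_law V (complete_edges V) (1 / card V) (16 * t). f x \<noteq> f y)"
proof -
  have "\<P>((x, y) in exclusion_law V (complete_edges V) (1 / card V) (16 * t). f x \<noteq> f y)
      = 2 * (ip (configs V) f f - ip (configs V) f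
          (excl_semigroup (complete_edges V) (1 / card V) (16 * t) f)) / card (configs V)"
    by (rule prob_exclusion_law_neq[OF simple_complete[OF G] _ _ f]) (use t in auto)
  then show ?thesis
    using ip_excl_semigroup_complete_le[OF \<alpha> t, of f]
    by (simp add: prob_exclusion_law_neq[OF G \<alpha>(1) t f] divide_right_mono)
qed

end

theorem theorem1p3:
  fixes V :: "nat \<Rightarrow> 'v set" and E :: "nat \<Rightarrow> 'v set set"
    and f :: "nat \<Rightarrow> ('v \<Rightarrow> nat) \<Rightarrow> real" and \<alpha> :: "nat \<Rightarrow> real"
  assumes "\<And>n. n \<ge> 1 \<Longrightarrow> simple_graph (V n) (E n)"
    and "\<And>n. n \<ge> 1 \<Longrightarrow> connected_graph (V n) (E n)"
    and "\<And>n. n \<ge> 1 \<Longrightarrow> f n \<in> configs (V n) \<rightarrow> {0, 1}"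
    and "\<And>n. n \<ge> 1 \<Longrightarrow> \<alpha> n > 0"
    and "\<And>n. n \<ge> 1 \<Longrightarrow> max_degree (V n) (E n) > 0 \<Longrightarrow> \<alpha> n \<le> 1 / real (max_degree (V n) (E n))"
  shows "(exclusion_sensitive f V E \<alpha> \<longrightarrow>
            exclusion_sensitive f V (\<lambda>n. complete_edges (V n)) (\<lambda>n. 1 / real (card (V n)))) \<and>
         (exclusion_stable f V (\<lambda>n. complete_edges (V n)) (\<lambda>n. 1 / real (card (V n))) \<longrightarrow>
            exclusion_stable f V E \<alpha>)"
proof -
  have \<alpha>: "0 \<le> \<alpha> n" "\<alpha> n * max_degree (V n) (E n) \<le> 1" if "n \<ge> 1" for n
  proof -
    show "0 \<le> \<alpha> n" using assms(4)[OF that] by simp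
    \<comment> \<open>The product form of the rate bound also covers maximal degree 0, where it
      reads \<open>0 \<le> 1\<close>.\<close>
    show "\<alpha> n * max_degree (V n) (E n) \<le> 1"
    proof (cases "max_degree (V n) (E n) = 0")
      case False
      then show ?thesis using assms(5)[OF that] by (simp add: field_simps)
    qed simp
  qed
  have sensitive: "exclusion_sensitive f V (\<lambda>n. complete_edges (V n)) (\<lambda>n. 1 / real (card (V n)))"
    if "exclusion_sensitive f V E \<alpha>"
  proof -
    define c where "c n = covariance (exclusion_law (V n) (E n) (\<alpha> n) 1)
      (\<lambda>(x, y). f n x) (\<lambda>(x, y). f n y)" for n
    define k where "k n = covariance (exclusion_law (V n) (complete_edges (V n)) (1 / card (V n)) 1)
      (\<lambda>(x, y). f n x) (\<lambda>(x, y). f n y)" for n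
    have k: "0 \<le> k n" "k n ^ 16 \<le> c n" if "n \<ge> 1" for n
      unfolding k_def c_def
      using covariance_complete_power_le[OF assms(1)[OF that] \<alpha>[OF that] assms(3)[OF that]] by auto
    have "c \<longlonglongrightarrow> 0" using that by (simp add: exclusion_sensitive_def c_def[abs_def])
    with tendsto_const have "(\<lambda>n. k n ^ 16) \<longlonglongrightarrow> 0"
      by (rule tendsto_sandwich[rotated 2]) (auto intro!: eventually_sequentiallyI[of 1] k)
    \<comment> \<open>The 16th root recovers \<open>k n\<close> from its power because
      \<open>k n\<close> is nonnegative for \<open>n \<ge> 1\<close>.\<close>
    then have "(\<lambda>n. root 16 (k n ^ 16)) \<longlonglongrightarrow> root 16 0"
      by (rule tendsto_real_root)
    moreover have "eventually (\<lambda>n. root 16 (k n ^ 16) = k n) sequentially"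
      by (intro eventually_sequentiallyI[of 1]) (simp add: real_root_power_cancel k)
    ultimately have "k \<longlonglongrightarrow> 0" by (simp add: tendsto_cong)
    then show ?thesis by (simp add: exclusion_sensitive_def k_def[abs_def])
  qed
  have stable: "exclusion_stable f V E \<alpha>"
    if "exclusion_stable f V (\<lambda>n. complete_edges (V n)) (\<lambda>n. 1 / real (card (V n)))"
  proof -
    define p where "p \<epsilon> n = \<P>((x, y) in exclusion_law (V n) (E n) (\<alpha> n) \<epsilon>. f n x \<noteq> f n y)" for \<epsilon> n
    define q where "q \<epsilon> n = \<P>((x, y) in exclusion_law (V n) (complete_edges (V n)) (1 / card (V n)) \<epsilon>.
      f n x \<noteq> f n y)" for \<epsilon> n
    have "((\<lambda>\<epsilon>. limsup (\<lambda>n. ereal (q \<epsilon> n))) \<longlongrightarrow> 0) (at_right 0)"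
      using that by (simp add: exclusion_stable_def q_def)
    \<comment> \<open>A constant factor in time does not affect the limit at 0 from the
      right.\<close>
    moreover have "filterlim (\<lambda>\<epsilon>::real. 16 * \<epsilon>) (at_right 0) (at_right 0)"
      by (rule filterlim_times_pos[where p = 0]) (auto simp: filterlim_ident)
    ultimately have q: "((\<lambda>\<epsilon>. limsup (\<lambda>n. ereal (q (16 * \<epsilon>) n))) \<longlongrightarrow> 0) (at_right 0)"
      by (rule filterlim_compose)
    have pq: "p \<epsilon> n \<le> q (16 * \<epsilon>) n" if "n \<ge> 1" "0 < \<epsilon>" for \<epsilon> n
      unfolding p_def q_def
      using prob_neq_le_complete[OF assms(1)[OF that(1)] \<alpha>[OF that(1)] assms(3)[OF that(1)]] that(2)
      by simp
    have "((\<lambda>\<epsilon>. limsup (\<lambda>n. ereal (p \<epsilon> n))) \<longlongrightarrow> 0) (at_right 0)"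
    proof (rule tendsto_sandwich[OF _ _ tendsto_const q])
      have "0 \<le> limsup (\<lambda>n. ereal (p \<epsilon> n))" for \<epsilon>
        by (rule le_Limsup) (auto simp: p_def)
      then show "\<forall>\<^sub>F \<epsilon> in at_right 0. 0 \<le> limsup (\<lambda>n. ereal (p \<epsilon> n))" by simp
      \<comment> \<open>The bound \<open>pq\<close> starts at \<open>n = 1\<close>; the limit
        superior ignores the index 0.\<close>
      have "limsup (\<lambda>n. ereal (p \<epsilon> n)) \<le> limsup (\<lambda>n. ereal (q (16 * \<epsilon>) n))" if "0 < \<epsilon>" for \<epsilon>
        by (intro Limsup_mono eventually_sequentiallyI[of 1]) (use pq that in auto)
      then show "\<forall>\<^sub>F \<epsilon> in at_right 0. limsup (\<lambda>n. ereal (p \<epsilon> n)) \<le> limsup (\<lambda>n. ereal (q (16 * \<epsilon>) n))"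
        by (auto simp: eventually_at_right_field intro!: exI[of _ 1])
    qed
    then show ?thesis by (simp add: exclusion_stable_def p_def)
  qed
  show ?thesis using sensitive stable by blast
qed

end
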